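(* The class of EDS is not closed under topological factor maps, even if we restrict to zero-dimensional spaces. That is, there exist a finitely generated group $\Gamma$, an EDS $\Gamma\curvearrowright X$ with $X$ zero-dimensional, and an action $\Gamma\curvearrowright Y$ by homeomorphisms on a zero-dimensional space $Y$ which is a topological factor of $\Gamma\curvearrowright X$ and is not an EDS.
   Context: Zero-dimensional means compact, metrizable and of topological dimension zero. A topological factor map from $\Gamma\curvearrowright X$ to $\Gamma\curvearrowright Y$ is a continuous surjective $\Gamma$-equivariant map $X\to Y$ (then $\Gamma\curvearrowright Y$ is a topological factor of $\Gamma\curvearrowright X$); it is a topological conjugacy if it is a homeomorphism. A computable metric space is $(X,d,\mathcal{S})$ where $(X,d)$ is a separable metric space, $\mathcal{S}=\{s_i: i\ge 0\}$ is dense, and there is an algorithm which on input $(i,j,n)$ outputs $r\in\mathbb{Q}$ with $|d(s_i,s_j)-r|\le 2^{-n}$. Basic balls are open balls centered at points of $\mathcal{S}$ with positive rational radius; fix a computable enumeration $(B_n)_{n\in\mathbb{N}}$ of them and put $U_I=\bigcup_{n\in I}B_n$. A compact set $K\subset X$ is recursively compact if there is an algorithm which, given a finite $I\subset\mathbb{N}$, halts iff $K\subset U_I$. A map $f\colon Y\subset X\to X'$ between computable metric spaces is computable if there is an algorithm which, given $m$, enumerates $I_m$ with $f^{-1}(B'_m)=U_{I_m}\cap Y$, where $(B'_m)_m$ enumerates the basic balls of $X'$. An action of a finitely generated group by homeomorphisms on a recursively compact subset of a computable metric space is computable if for some (equivalently any) finite generating set each generator acts by a computable map. An action of a finitely generated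 group on a compact metrizable space is an effective dynamical system (EDS) if it is topologically conjugate to a computable action on some recursively compact subset of a computable metric space (the conjugacy need not be computable). *)

theory Defs
  imports
    "HOL-Analysis.Analysis"
    "HOL-Library.Countable"
    "HOL-Library.Nat_Bijection"
    "HOL-Algebra.Generated_Groups"
    "HOL-Algebra.Group_Action"
begin

section \<open>Algorithms\<close>

text \<open>Algorithms are Kleene's partial recursive functions, given by programs that are run on
  lists of arguments; the value \<^const>\<open>None\<close> stands for divergence (or a wrong number of arguments).
  Finite sets of naturals are passed as arguments via their canonical index
  (\<^const>\<open>set_encode\<close>, \<^const>\<open>set_decode\<close>), rationals via the surjection \<^const>\<open>nat_to_rat_surj\<close>.\<close>

datatype recf =
    Zero
  | Succ
  | Proj nat
  | Comp recf "recf list"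
  | PrimRec recf recf
  | Mu recf

text \<open>In \<^term>\<open>PrimRec f g\<close> the recursion runs over the first argument, and the step function
  receives the counter, the previous value and the parameters, in this order.
  In \<^term>\<open>Mu f\<close> the search variable is the first argument of \<^term>\<open>f\<close>, and the search diverges if
  \<^term>\<open>f\<close> diverges before a zero has been found.\<close>

fun run :: "recf \<Rightarrow> nat list \<Rightarrow> nat option" where
  "run Zero xs = Some 0"
| "run Succ xs = (case xs of [x] \<Rightarrow> Some (Suc x) | _ \<Rightarrow> None)"
| "run (Proj i) xs = (if i < length xs then Some (xs ! i) else None)"
| "run (Comp f gs) xs =
    (let ys = map (\<lambda>g. run g xs) gs in if None \<in> set ys then None else run f (map the ys))"
| "run (PrimRec f g) xs =
    (case xs of [] \<Rightarrow> None
     | n # ps \<Rightarrow> rec_nat (run f ps) (\<lambda>k r. Option.bind r (\<lambda>v. run g (k # v # ps))) n)"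
| "run (Mu f) xs =
    (if \<exists>n. run f (n # xs) = Some 0 \<and> (\<forall>k<n. run f (k # xs) \<noteq> None)
     then Some (LEAST n. run f (n # xs) = Some 0) else None)"

section \<open>Computable metric spaces\<close>

definition computable_metric_space :: "'c metric \<Rightarrow> (nat \<Rightarrow> 'c) \<Rightarrow> bool" where
  "computable_metric_space m s \<longleftrightarrow>
     range s \<subseteq> mspace m \<and>
     Abstract_Topology.closure_of (mtopology_of m) (range s) = mspace m \<and>
     (\<exists>p. \<forall>i j n. \<exists>r. run p [i, j, n] = Some r \<and>
        \<bar>mdist m (s i) (s j) - real_of_rat (nat_to_rat_surj r)\<bar> \<le> (1/2) ^ n)"

text \<open>The radii \<open>(a + 1) / (b + 1)\<close> run through all positive rationals.\<close>

definition basic_ball :: "'c metric \<Rightarrow> (nat \<Rightarrow> 'c) \<Rightarrow> nat \<Rightarrow> 'c set" where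
  "basic_ball m s n =
     (let (i, k) = prod_decode n; (a, b) = prod_decode k
      in mball_of m (s i) (real (Suc a) / real (Suc b)))"

definition recursively_compact :: "'c metric \<Rightarrow> (nat \<Rightarrow> 'c) \<Rightarrow> 'c set \<Rightarrow> bool" where
  "recursively_compact m s K \<longleftrightarrow>
     compactin (mtopology_of m) K \<and>
     (\<exists>p. \<forall>I. finite I \<longrightarrow>
        (run p [set_encode I] \<noteq> None \<longleftrightarrow> K \<subseteq> (\<Union>n\<in>I. basic_ball m s n)))"

text \<open>The program \<open>p\<close> enumerates the set of its outputs on the inputs \<open>(j, 0), (j, 1), \<dots>\<close>;
  since it may diverge on some of them, this set is an arbitrary r.e. set, possibly empty.\<close>

definition computable_map_on ::
  "'c metric \<Rightarrow> (nat \<Rightarrow> 'c) \<Rightarrow> 'c set \<Rightarrow> 'd metric \<Rightarrow> (nat \<Rightarrow> 'd) \<Rightarrow> ('c \<Rightarrow> 'd) \<Rightarrow> bool" where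
  "computable_map_on m s Y m' s' f \<longleftrightarrow>
     f ` Y \<subseteq> mspace m' \<and>
     (\<exists>p. \<forall>j. {y \<in> Y. f y \<in> basic_ball m' s' j} =
        (\<Union>n\<in>{n. \<exists>k. run p [j, k] = Some n}. basic_ball m s n) \<inter> Y)"

section \<open>Topological dynamics\<close>

text \<open>\<^term>\<open>X dim_le 0\<close> also holds for the empty space, whose dimension is \<open>-1\<close>.\<close>

definition zero_dimensional :: "'a topology \<Rightarrow> bool" where
  "zero_dimensional X \<longleftrightarrow>
     compact_space X \<and> metrizable_space X \<and> X dim_le 0 \<and> topspace X \<noteq> {}"

definition finitely_generated_group :: "('g, 'z) monoid_scheme \<Rightarrow> bool" where
  "finitely_generated_group \<Gamma> \<longleftrightarrow>
     group \<Gamma> \<and> (\<exists>S. finite S \<and> S \<subseteq> carrier \<Gamma> \<and> generate \<Gamma> S = carrier \<Gamma>)"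

definition homeomorphism_action ::
  "('g, 'z) monoid_scheme \<Rightarrow> 'a topology \<Rightarrow> ('g \<Rightarrow> 'a \<Rightarrow> 'a) \<Rightarrow> bool" where
  "homeomorphism_action \<Gamma> X \<phi> \<longleftrightarrow>
     group_action \<Gamma> (topspace X) \<phi> \<and> (\<forall>g\<in>carrier \<Gamma>. homeomorphic_map X X (\<phi> g))"

definition topological_factor_map ::
  "('g, 'z) monoid_scheme \<Rightarrow> 'a topology \<Rightarrow> ('g \<Rightarrow> 'a \<Rightarrow> 'a) \<Rightarrow>
   'b topology \<Rightarrow> ('g \<Rightarrow> 'b \<Rightarrow> 'b) \<Rightarrow> ('a \<Rightarrow> 'b) \<Rightarrow> bool" where
  "topological_factor_map \<Gamma> X \<phi> Y \<psi> f \<longleftrightarrow>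
     continuous_map X Y f \<and> f ` topspace X = topspace Y \<and>
     (\<forall>g\<in>carrier \<Gamma>. \<forall>x\<in>topspace X. f (\<phi> g x) = \<psi> g (f x))"

definition topologically_conjugate ::
  "('g, 'z) monoid_scheme \<Rightarrow> 'a topology \<Rightarrow> ('g \<Rightarrow> 'a \<Rightarrow> 'a) \<Rightarrow>
   'b topology \<Rightarrow> ('g \<Rightarrow> 'b \<Rightarrow> 'b) \<Rightarrow> bool" where
  "topologically_conjugate \<Gamma> X \<phi> Y \<psi> \<longleftrightarrow>
     (\<exists>f. topological_factor_map \<Gamma> X \<phi> Y \<psi> f \<and> homeomorphic_map X Y f)"

section \<open>Effective dynamical systems\<close>

definition computable_action ::
  "('g, 'z) monoid_scheme \<Rightarrow> 'c metric \<Rightarrow> (nat \<Rightarrow> 'c) \<Rightarrow> 'c set \<Rightarrow> ('g \<Rightarrow> 'c \<Rightarrow> 'c) \<Rightarrow> bool" where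
  "computable_action \<Gamma> m s K \<alpha> \<longleftrightarrow>
     homeomorphism_action \<Gamma> (subtopology (mtopology_of m) K) \<alpha> \<and>
     (\<exists>S. finite S \<and> S \<subseteq> carrier \<Gamma> \<and> generate \<Gamma> S = carrier \<Gamma> \<and>
        (\<forall>g\<in>S. computable_map_on m s K m s (\<alpha> g)))"

text \<open>The points of the computable metric space are taken from a type of the cardinality of the
  continuum, since HOL cannot quantify over types within a formula. This is no restriction, because
  separable metric spaces have at most that many points; see \<open>effective_dynamical_systemI\<close>.\<close>

definition effective_dynamical_system ::
  "('g, 'z) monoid_scheme \<Rightarrow> 'a topology \<Rightarrow> ('g \<Rightarrow> 'a \<Rightarrow> 'a) \<Rightarrow> bool" where
  "effective_dynamical_system \<Gamma> X \<phi> \<longleftrightarrow>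
     (\<exists>(m :: (nat \<Rightarrow> nat) metric) s K \<alpha>.
        computable_metric_space m s \<and> recursively_compact m s K \<and>
        computable_action \<Gamma> m s K \<alpha> \<and>
        topologically_conjugate \<Gamma> X \<phi> (subtopology (mtopology_of m) K) \<alpha>)"

lemma basic_ball_subset_mspace: "basic_ball m s n \<subseteq> mspace m"
  by (auto simp: basic_ball_def split: prod.splits)

lemma basic_balls_separate_points:
  assumes "computable_metric_space m s" "x \<in> mspace m" "y \<in> mspace m" "x \<noteq> y"
  shows "\<exists>n. x \<in> basic_ball m s n \<and> y \<notin> basic_ball m s n"
proof -
  have sM: "range s \<subseteq> mspace m" and dense: "Abstract_Topology.closure_of (mtopology_of m) (range s) = mspace m"
    using assms(1) by (auto simp: computable_metric_space_def)
  have pos: "mdist m x y > 0"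
    using assms by (metis mdist_nonneg mdist_zero order_le_less)
  then obtain b where b: "inverse (real (Suc b)) < mdist m x y / 2"
    using reals_Archimedean[of "mdist m x y / 2"] by auto
  have "x \<in> Abstract_Topology.closure_of (Metric_space.mtopology (mspace m) (mdist m)) (range s)"
    using dense assms(2) by (simp add: mtopology_of_def)
  then have "\<forall>r>0. \<exists>z\<in>range s. z \<in> Metric_space.mball (mspace m) (mdist m) x r"
    by (simp add: Metric_space.metric_closure_of)
  then obtain i where i: "s i \<in> Metric_space.mball (mspace m) (mdist m) x (inverse (real (Suc b)))"
    by (metis inverse_positive_iff_positive of_nat_0_less_iff rangeE zero_less_Suc)
  then have xi: "mdist m x (s i) < inverse (real (Suc b))"
    by (simp add: Metric_space.in_mball)
  have si: "s i \<in> mspace m" using sM by auto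
  have tri: "mdist m x y \<le> mdist m x (s i) + mdist m (s i) y"
    by (rule mdist_triangle[OF assms(2) si assms(3)])
  let ?n = "prod_encode (i, prod_encode (0, b))"
  have B: "basic_ball m s ?n = mball_of m (s i) (inverse (real (Suc b)))"
    by (simp add: basic_ball_def inverse_eq_divide)
  show ?thesis
    using B xi tri b si assms(2) by (intro exI[of _ ?n]) (auto simp: mdist_commute)
qed

text \<open>The points may come from any type: they are identified by the basic balls that contain them.\<close>

lemma effective_dynamical_systemI:
  fixes m :: "'c metric"
  assumes cms: "computable_metric_space m s"
    and K: "recursively_compact m s K"
    and act: "computable_action \<Gamma> m s K \<alpha>"
    and conj: "topologically_conjugate \<Gamma> X \<phi> (subtopology (mtopology_of m) K) \<alpha>"
  shows "effective_dynamical_system \<Gamma> X \<phi>"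
proof -
  define M where "M = mspace m"
  define e :: "'c \<Rightarrow> nat \<Rightarrow> nat" where "e x = (\<lambda>n. if x \<in> basic_ball m s n then 1 else 0)" for x
  define h where "h = inv_into M e"
  have inj: "inj_on e M"
  proof (rule inj_onI, rule ccontr)
    fix x y assume "x \<in> M" "y \<in> M" and eq: "e x = e y" and "x \<noteq> y"
    then obtain n where n: "x \<in> basic_ball m s n" "y \<notin> basic_ball m s n"
      using basic_balls_separate_points[OF cms] unfolding M_def by blast
    show False using fun_cong[OF eq, of n] n by (simp add: e_def)
  qed
  have he [simp]: "h (e x) = x" if "x \<in> M" for x
    using inj that by (simp add: h_def)
  have KM: "K \<subseteq> M"
    using K compactin_subset_topspace[of "mtopology_of m" K] by (simp add: recursively_compact_def M_def)
  have sM: "s i \<in> M" for i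
    using cms by (auto simp: computable_metric_space_def M_def)
  define m' where "m' = metric (e ` M, \<lambda>x y. mdist m (h x) (h y))"
  define s' where "s' = e \<circ> s"
  define K' where "K' = e ` K"
  define \<alpha>' where "\<alpha>' g = restrict (\<lambda>x. e (\<alpha> g (h x))) K'" for g
  have mM: "mspace m = M"
    by (simp add: M_def)
  interpret MS: Metric_space "e ` M" "\<lambda>x y. mdist m (h x) (h y)"
    by unfold_locales (auto simp: mM mdist_commute mdist_triangle)
  have M' [simp]: "mspace m' = e ` M" and d': "mdist m' = (\<lambda>x y. mdist m (h x) (h y))"
    by (simp_all add: m'_def)
  have d'e [simp]: "mdist m' (e x) (e y) = mdist m x y" if "x \<in> M" "y \<in> M" for x y
    using that by (simp add: d')
  have homeo: "homeomorphic_maps (mtopology_of m) (mtopology_of m') e h"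
    unfolding homeomorphic_maps_def
  proof (intro conjI)
    have "Lipschitz_continuous_map m m' e"
      unfolding Lipschitz_continuous_map_def
      by (intro conjI exI[of _ 1]) (auto simp: mM)
    then show "continuous_map (mtopology_of m) (mtopology_of m') e"
      by (rule Lipschitz_continuous_imp_continuous_map)
    have "Lipschitz_continuous_map m' m h"
      unfolding Lipschitz_continuous_map_def
      by (intro conjI exI[of _ 1]) (auto simp: mM)
    then show "continuous_map (mtopology_of m') (mtopology_of m) h"
      by (rule Lipschitz_continuous_imp_continuous_map)
  qed (auto simp: mM)
  then have hom_e: "homeomorphic_map (mtopology_of m) (mtopology_of m') e"
    using homeomorphic_maps_map by blast
  have ball: "basic_ball m' s' n = e ` basic_ball m s n" for n
    using sM by (force simp: basic_ball_def s'_def mM split: prod.splits)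
  have ballM: "basic_ball m s n \<subseteq> M" for n
    unfolding M_def by (rule basic_ball_subset_mspace)
  have cms': "computable_metric_space m' s'"
  proof -
    have "Abstract_Topology.closure_of (mtopology_of m') (range s') = e ` Abstract_Topology.closure_of (mtopology_of m) (range s)"
      using homeomorphic_map_closure_of[OF hom_e, of "range s"] sM
      by (auto simp: s'_def image_comp M_def)
    then have "Abstract_Topology.closure_of (mtopology_of m') (range s') = mspace m'"
      using cms by (simp add: computable_metric_space_def mM)
    moreover have "mdist m' (s' i) (s' j) = mdist m (s i) (s j)" for i j
      using sM by (simp add: s'_def)
    moreover have "range s' \<subseteq> mspace m'"
      using sM by (auto simp: s'_def)
    ultimately show ?thesis
      using cms by (simp add: computable_metric_space_def)
  qed
  have K': "recursively_compact m' s' K'"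
  proof -
    have "compactin (mtopology_of m') K'"
      using homeomorphic_map_compactness[OF hom_e] K KM
      by (simp add: recursively_compact_def K'_def M_def)
    moreover have "K' \<subseteq> (\<Union>n\<in>I. basic_ball m' s' n) \<longleftrightarrow> K \<subseteq> (\<Union>n\<in>I. basic_ball m s n)" for I
      unfolding K'_def ball image_UN[symmetric]
      using inj KM ballM by (intro inj_on_image_subset_iff[of e M]) auto
    ultimately show ?thesis
      using K by (simp add: recursively_compact_def)
  qed
  have hom_K: "homeomorphic_maps (subtopology (mtopology_of m) K) (subtopology (mtopology_of m') K') e h"
    using homeo KM by (intro homeomorphic_maps_subtopologies) (auto simp: K'_def M_def)
  have topK: "topspace (subtopology (mtopology_of m) K) = K"
    using KM by (auto simp: M_def)
  have topK': "topspace (subtopology (mtopology_of m') K') = K'"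
    using KM by (auto simp: K'_def)
  have ga: "group_action \<Gamma> K \<alpha>"
    and hom\<alpha>: "\<And>g. g \<in> carrier \<Gamma> \<Longrightarrow>
      homeomorphic_map (subtopology (mtopology_of m) K) (subtopology (mtopology_of m) K) (\<alpha> g)"
    using act topK by (auto simp: computable_action_def homeomorphism_action_def)
  interpret ga: group_action \<Gamma> K \<alpha> by (rule ga)
  interpret G: group \<Gamma>
    using ga by (simp add: group_action_def group_hom_def)
  have \<alpha>K: "\<alpha> g x \<in> K" if "g \<in> carrier \<Gamma>" "x \<in> K" for g x
    using ga.element_image that by blast
  have hK: "h y \<in> K" if "y \<in> K'" for y
    using that KM by (auto simp: K'_def)
  have eK: "e x \<in> K'" if "x \<in> K" for x
    using that by (auto simp: K'_def)
  have eh: "e (h y) = y" if "y \<in> K'" for y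
    using that KM by (auto simp: K'_def)
  have he_K: "h (e x) = x" if "x \<in> K" for x
    using that KM by auto
  have \<alpha>'e: "\<alpha>' g (e x) = e (\<alpha> g x)" if "x \<in> K" for g x
    using that by (simp add: \<alpha>'_def eK he_K)
  have bij': "\<alpha>' g \<in> Bij K'" if g: "g \<in> carrier \<Gamma>" for g
  proof -
    have "bij_betw (\<alpha> g) K K"
      using ga.bij_prop0[OF g] by (simp add: Bij_def)
    moreover have "bij_betw h K' K"
      by (rule bij_betw_byWitness[where f' = e]) (auto simp: hK eK eh he_K)
    moreover have "bij_betw e K K'"
      by (rule bij_betw_byWitness[where f' = h]) (auto simp: hK eK eh he_K)
    ultimately have "bij_betw (e \<circ> (\<alpha> g \<circ> h)) K' K'"
      by (blast intro: bij_betw_trans)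
    then have "bij_betw (\<alpha>' g) K' K'"
      by (rule bij_betw_cong[THEN iffD1, rotated]) (simp add: \<alpha>'_def)
    then show ?thesis
      by (simp add: Bij_def \<alpha>'_def)
  qed
  have ga': "group_action \<Gamma> K' \<alpha>'"
    unfolding group_action_def group_hom_def group_hom_axioms_def
  proof (intro conjI homI)
    show "group \<Gamma>" by (rule G.is_group)
    show "group (BijGroup K')" by (rule group_BijGroup)
    show "\<alpha>' g \<in> carrier (BijGroup K')" if "g \<in> carrier \<Gamma>" for g
      using bij' that by (simp add: BijGroup_def)
    show "\<alpha>' (a \<otimes>\<^bsub>\<Gamma>\<^esub> b) = \<alpha>' a \<otimes>\<^bsub>BijGroup K'\<^esub> \<alpha>' b"
      if ab: "a \<in> carrier \<Gamma>" "b \<in> carrier \<Gamma>" for a b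
    proof
      fix y
      show "\<alpha>' (a \<otimes>\<^bsub>\<Gamma>\<^esub> b) y = (\<alpha>' a \<otimes>\<^bsub>BijGroup K'\<^esub> \<alpha>' b) y"
      proof (cases "y \<in> K'")
        case True
        then obtain x where x: "x \<in> K" "y = e x" by (auto simp: K'_def)
        have "\<alpha> (a \<otimes>\<^bsub>\<Gamma>\<^esub> b) x = \<alpha> a (\<alpha> b x)"
          using ga.composition_rule[OF x(1)] ab by simp
        then show ?thesis
          using True x ab bij' by (simp add: BijGroup_def compose_def \<alpha>'e \<alpha>K)
      next
        case False
        then show ?thesis
          using ab bij' by (simp add: BijGroup_def compose_def) (simp add: \<alpha>'_def)
      qed
    qed
  qed
  have hom\<alpha>': "homeomorphic_map (subtopology (mtopology_of m') K') (subtopology (mtopology_of m') K') (\<alpha>' g)"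
    if g: "g \<in> carrier \<Gamma>" for g
  proof -
    have "homeomorphic_map (subtopology (mtopology_of m') K') (subtopology (mtopology_of m') K')
            (e \<circ> (\<alpha> g \<circ> h))"
      using hom_K hom\<alpha>[OF g]
      by (meson homeomorphic_map_compose homeomorphic_maps_map homeomorphic_maps_sym)
    then show ?thesis
      by (rule homeomorphic_map_eq) (simp add: topK' \<alpha>'_def)
  qed
  have comp: "computable_map_on m' s' K' m' s' (\<alpha>' g)"
    if c: "computable_map_on m s K m s (\<alpha> g)" for g
  proof -
    obtain p where p: "\<And>j. {y \<in> K. \<alpha> g y \<in> basic_ball m s j} =
        (\<Union>n\<in>{n. \<exists>k. run p [j, k] = Some n}. basic_ball m s n) \<inter> K"
      and sub: "\<alpha> g ` K \<subseteq> M"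
      using c unfolding computable_map_on_def M_def by blast
    have "{y \<in> K'. \<alpha>' g y \<in> basic_ball m' s' j} =
        (\<Union>n\<in>{n. \<exists>k. run p [j, k] = Some n}. basic_ball m' s' n) \<inter> K'" for j
    proof -
      have mem: "\<alpha>' g (e x) \<in> e ` basic_ball m s j \<longleftrightarrow> \<alpha> g x \<in> basic_ball m s j" if "x \<in> K" for x
        using inj_on_image_mem_iff[OF inj _ ballM] sub \<alpha>'e that by (simp add: image_subset_iff)
      have "{y \<in> K'. \<alpha>' g y \<in> basic_ball m' s' j} = e ` {y \<in> K. \<alpha> g y \<in> basic_ball m s j}"
        unfolding K'_def ball using mem by blast
      also have "\<dots> = e ` (\<Union>n\<in>{n. \<exists>k. run p [j, k] = Some n}. basic_ball m s n) \<inter> e ` K"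
        unfolding p using KM ballM by (intro inj_on_image_Int[OF inj]) auto
      finally show ?thesis
        by (simp add: ball image_UN K'_def)
    qed
    moreover have "\<alpha>' g ` K' \<subseteq> mspace m'"
      using sub \<alpha>'e by (auto simp: K'_def)
    ultimately show ?thesis
      unfolding computable_map_on_def by blast
  qed
  have act': "computable_action \<Gamma> m' s' K' \<alpha>'"
    using act comp ga' hom\<alpha>' topK'
    unfolding computable_action_def homeomorphism_action_def by metis
  obtain f where f: "topological_factor_map \<Gamma> X \<phi> (subtopology (mtopology_of m) K) \<alpha> f"
    and fh: "homeomorphic_map X (subtopology (mtopology_of m) K) f"
    using conj by (auto simp: topologically_conjugate_def)
  have fh': "homeomorphic_map X (subtopology (mtopology_of m') K') (e \<circ> f)"
    using fh hom_K by (meson homeomorphic_map_compose homeomorphic_maps_map)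
  have fK: "f x \<in> K" if "x \<in> topspace X" for x
    using f that topK unfolding topological_factor_map_def by blast
  have "topological_factor_map \<Gamma> X \<phi> (subtopology (mtopology_of m') K') \<alpha>' (e \<circ> f)"
    using f fh' homeomorphic_imp_continuous_map[OF fh'] homeomorphic_imp_surjective_map[OF fh']
    by (simp add: topological_factor_map_def \<alpha>'e fK)
  then have "topologically_conjugate \<Gamma> X \<phi> (subtopology (mtopology_of m') K') \<alpha>'"
    using fh' by (auto simp: topologically_conjugate_def)
  then show ?thesis
    using cms' K' act' unfolding effective_dynamical_system_def by blast
qed

end

theory Submission
  imports Defs
begin

text \<open>An effective dynamical system is determined, up to an equivariant bijection, by finitely many
  programs: one for the distances, one for the finite covers by basic balls, and one for each
  generator. Hence only countably many sets occur as the set of cardinalities of orbits of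
  an effective dynamical system of \<open>\<int>\<close>. On the other hand, let \<open>X\<close> consist of one cycle of length
  \<open>c + 1\<close> for every \<open>c \<ge> 1\<close>, together with a fixed point to which the cycles converge; this is
  effective. Collapsing an arbitrary family of cycles to the fixed point is a topological factor map,
  and the resulting factors realise uncountably many sets of orbit cardinalities.\<close>

section \<open>Computable functions\<close>

text \<open>The conjugacy onto a computable model may be uncomputable, so no program for the model
  can be traced back to the factor. The counting therefore needs an invariant that survives
  arbitrary equivariant bijections, and orbit cardinality is one. Distances between the dense points
  are fixed exactly by approximations of every precision, but they do not tell which limit points
  belong to the compact set. That is what the finite covers decide, and compactness is essential
  here. The generating set is chosen existentially in the definition, so a code must record it
  together with the programs. Having exactly one cycle of each length makes the orbit sizes remember
  precisely which cycles were kept. The cycles shrink towards the fixed point, which gives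
  compactness and leaves a limit into which any family can be collapsed without increasing
  distances. The argument is pure cardinality and exhibits no particular bad family.\<close>

definition computable :: "nat \<Rightarrow> (nat list \<Rightarrow> nat) \<Rightarrow> bool" where
  "computable k f \<longleftrightarrow> (\<exists>p. \<forall>xs. length xs = k \<longrightarrow> run p xs = Some (f xs))"

definition decidable :: "nat \<Rightarrow> (nat list \<Rightarrow> bool) \<Rightarrow> bool" where
  "decidable k P \<longleftrightarrow> computable k (\<lambda>xs. of_bool (P xs))"

lemma computable_cong:
  assumes "computable k f" "\<And>xs. length xs = k \<Longrightarrow> f xs = g xs"
  shows "computable k g"
  using assms unfolding computable_def by fastforce

lemma decidable_cong:
  assumes "decidable k P" "\<And>xs. length xs = k \<Longrightarrow> P xs = Q xs"
  shows "decidable k Q"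
  using assms computable_cong unfolding decidable_def by fastforce

lemma computable_comp:
  assumes "computable (length gs) f" "\<And>g. g \<in> set gs \<Longrightarrow> computable k g"
  shows "computable k (\<lambda>xs. f (map (\<lambda>g. g xs) gs))"
proof -
  obtain p where p: "\<And>ys. length ys = length gs \<Longrightarrow> run p ys = Some (f ys)"
    using assms(1) by (auto simp: computable_def)
  obtain q where q: "\<And>g xs. g \<in> set gs \<Longrightarrow> length xs = k \<Longrightarrow> run (q g) xs = Some (g xs)"
    using assms(2) unfolding computable_def by metis
  have "run (Comp p (map q gs)) xs = Some (f (map (\<lambda>g. g xs) gs))" if "length xs = k" for xs
  proof -
    have "map (\<lambda>r. run r xs) (map q gs) = map (\<lambda>g. Some (g xs)) gs"
      using q that by simp
    moreover have "map the (map (\<lambda>g. Some (g xs)) gs) = map (\<lambda>g. g xs) gs"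
      by simp
    ultimately show ?thesis
      using p by (auto simp: Let_def comp_def simp del: map_map)
  qed
  then show ?thesis
    unfolding computable_def by blast
qed

lemma computable_comp1:
  assumes "computable 1 (\<lambda>xs. F (xs ! 0))" "computable k f"
  shows "computable k (\<lambda>xs. F (f xs))"
  using computable_comp[of "[f]" "\<lambda>xs. F (xs ! 0)" k] assms by simp

lemma computable_comp2:
  assumes "computable 2 (\<lambda>xs. F (xs ! 0) (xs ! 1))" "computable k f" "computable k g"
  shows "computable k (\<lambda>xs. F (f xs) (g xs))"
  using computable_comp[of "[f, g]" "\<lambda>xs. F (xs ! 0) (xs ! 1)" k] assms
  by (auto simp: numeral_2_eq_2)

lemma computable_nth: "i < k \<Longrightarrow> computable k (\<lambda>xs. xs ! i)"
  unfolding computable_def by (rule exI[of _ "Proj i"]) simp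

text \<open>Search and quantifiers put one bound variable in front of the parameters, recursion puts
  two; the parameters then appear as \<open>tl xs ! i\<close> and \<open>tl (tl xs) ! i\<close>, and
  the introduction rules match these forms syntactically.\<close>

lemma computable_nth_tl: "Suc i < k \<Longrightarrow> computable k (\<lambda>xs. tl xs ! i)"
  by (rule computable_cong[OF computable_nth[of "Suc i"]]) (auto simp: nth_tl)

lemma computable_nth_tl2: "Suc (Suc i) < k \<Longrightarrow> computable k (\<lambda>xs. tl (tl xs) ! i)"
  by (rule computable_cong[OF computable_nth[of "Suc (Suc i)"]]) (auto simp: nth_tl)

lemma computable_Suc: "computable k f \<Longrightarrow> computable k (\<lambda>xs. Suc (f xs))"
proof (rule computable_comp1[where F = Suc])
  show "computable 1 (\<lambda>xs. Suc (xs ! 0))"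
    unfolding computable_def by (rule exI[of _ Succ]) (auto simp: length_Suc_conv)
qed

lemma computable_const: "computable k (\<lambda>xs. c)"
proof (induction c)
  case 0
  show ?case
    unfolding computable_def by (rule exI[of _ Zero]) simp
qed (rule computable_Suc)

text \<open>The added first argument is the place of a search or quantified variable; terms that do
  not mention it are lifted to the larger arity by this rule.\<close>

lemma computable_weaken:
  assumes "computable k f"
  shows "computable (Suc k) (\<lambda>xs. f (tl xs))"
proof (rule computable_cong)
  show "computable (Suc k) (\<lambda>xs. f (map (\<lambda>g. g xs) (map (\<lambda>i xs. xs ! Suc i) [0..<k])))"
    by (rule computable_comp) (use assms in \<open>auto intro: computable_nth\<close>)
  show "f (map (\<lambda>g. g xs) (map (\<lambda>i xs. xs ! Suc i) [0..<k])) = f (tl xs)" if "length xs = Suc k" for xs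
    by (rule arg_cong[of _ _ f]) (use that in \<open>auto intro!: nth_equalityI simp: nth_tl\<close>)
qed

lemma computable_rec_nat:
  assumes n: "computable k n" and f: "computable k f"
    and g: "computable (Suc (Suc k)) (\<lambda>ys. g (ys ! 0) (ys ! 1) (tl (tl ys)))"
  shows "computable k (\<lambda>xs. rec_nat (f xs) (\<lambda>m r. g m r xs) (n xs))"
proof -
  obtain p where p: "\<And>xs. length xs = k \<Longrightarrow> run p xs = Some (f xs)"
    using f by (auto simp: computable_def)
  obtain q where "\<And>ys. length ys = Suc (Suc k) \<Longrightarrow> run q ys = Some (g (ys ! 0) (ys ! 1) (tl (tl ys)))"
    using g by (auto simp: computable_def)
  then have q: "run q (m # r # xs) = Some (g m r xs)" if "length xs = k" for m r xs
    using that by simp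
  have "rec_nat (run p xs) (\<lambda>k r. Option.bind r (\<lambda>v. run q (k # v # xs))) m =
      Some (rec_nat (f xs) (\<lambda>m r. g m r xs) m)" if "length xs = k" for xs m
    by (induction m) (use that p q in auto)
  then have "computable (Suc k) (\<lambda>ys. rec_nat (f (tl ys)) (\<lambda>m r. g m r (tl ys)) (ys ! 0))"
    unfolding computable_def by (intro exI[of _ "PrimRec p q"]) (auto simp: length_Suc_conv)
  \<comment> \<open>\<open>PrimRec\<close> recurses only over its first argument; composing with
    \<open>n\<close> and the projections replaces that argument by \<open>n xs\<close>.\<close>
  then have "computable k (\<lambda>xs. (\<lambda>ys. rec_nat (f (tl ys)) (\<lambda>m r. g m r (tl ys)) (ys ! 0))
      (map (\<lambda>h. h xs) (n # map (\<lambda>i xs. xs ! i) [0..<k])))"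
    by (intro computable_comp) (use n in \<open>auto intro: computable_nth\<close>)
  then show ?thesis
  proof (rule computable_cong)
    fix xs :: "nat list" assume "length xs = k"
    then have "map (\<lambda>h. h xs) (map (\<lambda>i xs. xs ! i) [0..<k]) = xs"
      by (auto intro: nth_equalityI)
    then show "(\<lambda>ys. rec_nat (f (tl ys)) (\<lambda>m r. g m r (tl ys)) (ys ! 0))
      (map (\<lambda>h. h xs) (n # map (\<lambda>i xs. xs ! i) [0..<k])) =
      rec_nat (f xs) (\<lambda>m r. g m r xs) (n xs)"
      by simp
  qed
qed

lemmas computable_basic = computable_nth computable_nth_tl computable_nth_tl2 computable_Suc computable_const

section \<open>Arithmetic and Boolean operations\<close>

lemma computable_add:
  assumes "computable k f" "computable k g"
  shows "computable k (\<lambda>xs. f xs + g xs)"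
proof -
  have "rec_nat a (\<lambda>m r. Suc r) n = a + n" for a n :: nat
    by (induction n) auto
  moreover have "computable k (\<lambda>xs. rec_nat (f xs) (\<lambda>m r. Suc r) (g xs))"
    by (intro computable_rec_nat computable_basic assms) simp
  ultimately show ?thesis
    by simp
qed

text \<open>Passing first to two plain arguments avoids lifting \<open>f\<close> past the counter
  and the accumulator of the recursion.\<close>

lemma computable_mult:
  assumes "computable k f" "computable k g"
  shows "computable k (\<lambda>xs. f xs * g xs)"
proof (rule computable_comp2[OF _ assms])
  have "rec_nat 0 (\<lambda>m r. r + a) n = a * n" for a n :: nat
    by (induction n) auto
  moreover have "computable 2 (\<lambda>xs. rec_nat 0 (\<lambda>m r. r + xs ! 0) (xs ! 1))"
    by (intro computable_rec_nat computable_basic computable_add) simp_all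
  ultimately show "computable 2 (\<lambda>xs. xs ! 0 * xs ! 1)"
    by simp
qed

lemma computable_power:
  assumes "computable k f" "computable k g"
  shows "computable k (\<lambda>xs. f xs ^ g xs)"
proof (rule computable_comp2[OF _ assms])
  have "rec_nat 1 (\<lambda>m r. r * a) n = a ^ n" for a n :: nat
    by (induction n) auto
  moreover have "computable 2 (\<lambda>xs. rec_nat 1 (\<lambda>m r. r * xs ! 0) (xs ! 1))"
    by (intro computable_rec_nat computable_basic computable_mult) simp_all
  ultimately show "computable 2 (\<lambda>xs. xs ! 0 ^ xs ! 1)"
    by simp
qed

lemma computable_diff:
  assumes "computable k f" "computable k g"
  shows "computable k (\<lambda>xs. f xs - g xs)"
proof (rule computable_comp2[OF _ assms])
  have pred: "computable k (\<lambda>xs. h xs - 1)" if h: "computable k h" for k h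
  proof -
    have "rec_nat 0 (\<lambda>m r. m) n = n - 1" for n :: nat
      by (cases n) auto
    moreover have "computable k (\<lambda>xs. rec_nat 0 (\<lambda>m r. m) (h xs))"
      by (intro computable_rec_nat computable_basic h) simp
    ultimately show ?thesis
      by simp
  qed
  have "rec_nat a (\<lambda>m r. r - 1) n = a - n" for a n :: nat
    by (induction n) auto
  moreover have "computable 2 (\<lambda>xs. rec_nat (xs ! 0) (\<lambda>m r. r - 1) (xs ! 1))"
    by (intro computable_rec_nat computable_basic pred) simp_all
  ultimately show "computable 2 (\<lambda>xs. xs ! 0 - xs ! 1)"
    by simp
qed

lemma decidable_le:
  assumes "computable k f" "computable k g"
  shows "decidable k (\<lambda>xs. f xs \<le> g xs)"
proof -
  \<comment> \<open>Subtraction is truncated, so the inner difference vanishes exactly when the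
    inequality holds.\<close>
  have "computable k (\<lambda>xs. 1 - (f xs - g xs))"
    by (intro computable_diff computable_const assms)
  then show ?thesis
    unfolding decidable_def by (rule computable_cong) simp
qed

lemma decidable_not: "decidable k P \<Longrightarrow> decidable k (\<lambda>xs. \<not> P xs)"
  using computable_diff[OF computable_const[of k 1]] unfolding decidable_def
  by (rule computable_cong) auto

lemma decidable_conj:
  "decidable k P \<Longrightarrow> decidable k Q \<Longrightarrow> decidable k (\<lambda>xs. P xs \<and> Q xs)"
  using computable_mult[of k "\<lambda>xs. of_bool (P xs)" "\<lambda>xs. of_bool (Q xs)"]
  by (simp add: decidable_def of_bool_conj)

lemma decidable_disj:
  assumes "decidable k P" "decidable k Q"
  shows "decidable k (\<lambda>xs. P xs \<or> Q xs)"
proof -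
  have "decidable k (\<lambda>xs. \<not> (\<not> P xs \<and> \<not> Q xs))"
    by (intro decidable_not decidable_conj assms)
  then show ?thesis
    by simp
qed

lemma decidable_less:
  "computable k f \<Longrightarrow> computable k g \<Longrightarrow> decidable k (\<lambda>xs. f xs < g xs)"
  using decidable_le[OF computable_Suc] by (simp add: Suc_le_eq)

lemma decidable_eq:
  assumes "computable k f" "computable k g"
  shows "decidable k (\<lambda>xs. f xs = g xs)"
proof -
  have "decidable k (\<lambda>xs. f xs \<le> g xs \<and> g xs \<le> f xs)"
    by (intro decidable_conj decidable_le assms)
  then show ?thesis
    by (simp add: eq_iff)
qed

lemma computable_if:
  assumes "decidable k P" "computable k f" "computable k g"
  shows "computable k (\<lambda>xs. if P xs then f xs else g xs)"
proof -
  have "computable k (\<lambda>xs. of_bool (P xs) * f xs + (1 - of_bool (P xs)) * g xs)"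
    using assms(1) unfolding decidable_def
    by (intro computable_add computable_mult computable_diff computable_const assms)
  then show ?thesis
    by (rule computable_cong) simp
qed

text \<open>\<open>Mu\<close> looks for a zero, hence the negation. A decidable predicate has a
  total program, so the divergence clause of \<open>Mu\<close> never interferes. This is the source
  both of total minimisation and of programs that must diverge.\<close>

lemma unbounded_search:
  assumes "decidable (Suc k) (\<lambda>ys. P (ys ! 0) (tl ys))"
  shows "\<exists>p. \<forall>xs. length xs = k \<longrightarrow>
    run p xs = (if \<exists>m. P m xs then Some (LEAST m. P m xs) else None)"
proof -
  obtain q where "\<And>ys. length ys = Suc k \<Longrightarrow> run q ys = Some (of_bool (\<not> P (ys ! 0) (tl ys)))"
    using decidable_not[OF assms] by (auto simp: decidable_def computable_def)
  then have q: "run q (m # xs) = Some (of_bool (\<not> P m xs))" if "length xs = k" for m xs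
    using that by simp
  show ?thesis
    by (rule exI[of _ "Mu q"]) (simp add: q)
qed

lemma computable_Least:
  assumes "decidable (Suc k) (\<lambda>ys. P (ys ! 0) (tl ys))" "\<And>xs. length xs = k \<Longrightarrow> \<exists>m. P m xs"
  shows "computable k (\<lambda>xs. LEAST m. P m xs)"
  using unbounded_search[OF assms(1)] assms(2) unfolding computable_def by auto

text \<open>Searching for a witness or for the bound itself always halts, and it halts strictly
  below the bound exactly if there is a witness.\<close>

lemma decidable_bex:
  assumes "decidable (Suc k) (\<lambda>ys. P (ys ! 0) (tl ys))" "computable k b"
  shows "decidable k (\<lambda>xs. \<exists>m<b xs. P m xs)"
proof (rule decidable_cong)
  show "decidable k (\<lambda>xs. (LEAST m. P m xs \<or> b xs \<le> m) < b xs)"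
    by (intro decidable_less computable_Least decidable_disj decidable_le computable_weaken
        computable_nth assms) auto
  show "(LEAST m. P m xs \<or> b xs \<le> m) < b xs \<longleftrightarrow> (\<exists>m<b xs. P m xs)" for xs
  proof
    assume "\<exists>m<b xs. P m xs"
    then obtain m where "m < b xs" "P m xs" by blast
    then show "(LEAST m. P m xs \<or> b xs \<le> m) < b xs"
      using Least_le[of "\<lambda>m. P m xs \<or> b xs \<le> m" m] by simp
  next
    assume "(LEAST m. P m xs \<or> b xs \<le> m) < b xs"
    then show "\<exists>m<b xs. P m xs"
      using LeastI[of "\<lambda>m. P m xs \<or> b xs \<le> m" "b xs"] by auto
  qed
qed

lemma decidable_ball:
  assumes "decidable (Suc k) (\<lambda>ys. P (ys ! 0) (tl ys))" "computable k b"
  shows "decidable k (\<lambda>xs. \<forall>m<b xs. P m xs)"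
  using decidable_not[OF decidable_bex[OF decidable_not[OF assms(1)] assms(2)]] by simp

section \<open>Division, pairing and finite sets\<close>

lemma computable_div:
  assumes "computable k f" "computable k g"
  shows "computable k (\<lambda>xs. f xs div g xs)"
proof (rule computable_comp2[OF _ assms])
  \<comment> \<open>The disjunct \<open>y = 0\<close> stops the search at 0, which agrees with the
    convention \<open>x div 0 = 0\<close>.\<close>
  have "(LEAST q. y = 0 \<or> x < Suc q * y) = x div y" for x y :: nat
  proof (cases "y = 0")
    case False
    have "x < Suc (x div y) * y"
      using False dividend_less_div_times[of y x] by (simp add: algebra_simps)
    moreover have "x div y \<le> q" if "x < Suc q * y" for q
      using False less_mult_imp_div_less[OF that] by simp
    ultimately show ?thesis
      using False by (intro Least_equality) auto
  qed simp
  moreover have "\<exists>q. y = 0 \<or> x < Suc q * y" for x y :: nat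
    by (cases y) (auto intro!: exI[of _ x])
  then have "computable 2 (\<lambda>xs. LEAST q. xs ! 1 = 0 \<or> xs ! 0 < Suc q * xs ! 1)"
    by (intro computable_Least decidable_disj decidable_eq decidable_less computable_mult
        computable_basic) simp_all
  ultimately show "computable 2 (\<lambda>xs. xs ! 0 div xs ! 1)"
    by simp
qed

lemma computable_triangle: "computable k f \<Longrightarrow> computable k (\<lambda>xs. triangle (f xs))"
  unfolding triangle_def by (intro computable_basic computable_mult computable_div)

lemma computable_prod_encode:
  "computable k f \<Longrightarrow> computable k g \<Longrightarrow> computable k (\<lambda>xs. prod_encode (f xs, g xs))"
  unfolding prod_encode_def by (simp add: computable_triangle computable_add)

text \<open>The pairing is inverted by search; components never exceed their code, so the other
  component ranges over a bounded set.\<close>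

lemma computable_fst_prod_decode:
  assumes "computable k f"
  shows "computable k (\<lambda>xs. fst (prod_decode (f xs)))"
proof (rule computable_comp1[OF _ assms])
  have ex: "\<exists>b<Suc n. prod_encode (fst (prod_decode n), b) = n" for n
    by (rule exI[of _ "snd (prod_decode n)"])
      (use le_prod_encode_2[of "snd (prod_decode n)" "fst (prod_decode n)"] in \<open>simp add: less_Suc_eq_le\<close>)
  then have "(LEAST a. \<exists>b<Suc n. prod_encode (a, b) = n) = fst (prod_decode n)" for n
    by (intro Least_equality) auto
  moreover have "computable 1 (\<lambda>xs. LEAST a. \<exists>b<Suc (xs ! 0). prod_encode (a, b) = xs ! 0)"
    by (intro computable_Least decidable_bex decidable_eq computable_prod_encode
        computable_basic) (use ex in \<open>simp_all, blast\<close>)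
  ultimately show "computable 1 (\<lambda>xs. fst (prod_decode (xs ! 0)))"
    by simp
qed

lemma computable_snd_prod_decode:
  assumes "computable k f"
  shows "computable k (\<lambda>xs. snd (prod_decode (f xs)))"
proof (rule computable_comp1[OF _ assms])
  have ex: "\<exists>a<Suc n. prod_encode (a, snd (prod_decode n)) = n" for n
    by (rule exI[of _ "fst (prod_decode n)"])
      (use le_prod_encode_1[of "fst (prod_decode n)" "snd (prod_decode n)"] in \<open>simp add: less_Suc_eq_le\<close>)
  then have "(LEAST b. \<exists>a<Suc n. prod_encode (a, b) = n) = snd (prod_decode n)" for n
    by (intro Least_equality) auto
  moreover have "computable 1 (\<lambda>xs. LEAST b. \<exists>a<Suc (xs ! 0). prod_encode (a, b) = xs ! 0)"
    by (intro computable_Least decidable_bex decidable_eq computable_prod_encode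
        computable_basic) (use ex in \<open>simp_all, blast\<close>)
  ultimately show "computable 1 (\<lambda>xs. snd (prod_decode (xs ! 0)))"
    by simp
qed

lemma decidable_mem_set_decode:
  assumes "computable k f" "computable k g"
  shows "decidable k (\<lambda>xs. f xs \<in> set_decode (g xs))"
proof -
  \<comment> \<open>Membership is oddness of a quotient, expressed by halving and doubling.\<close>
  have "decidable k (\<lambda>xs. \<not> g xs div 2 ^ f xs = 2 * (g xs div 2 ^ f xs div 2))"
    by (intro decidable_not decidable_eq computable_mult computable_div computable_power
        computable_const assms)
  moreover have "odd n \<longleftrightarrow> n \<noteq> 2 * (n div 2)" for n :: nat
    by presburger
  ultimately show ?thesis
    by (simp only: set_decode_def mem_Collect_eq)
qed

lemmas computability_intros =
  computable_basic computable_add computable_mult computable_power computable_diff computable_if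
  computable_div computable_triangle computable_prod_encode computable_fst_prod_decode
  computable_snd_prod_decode decidable_le decidable_less decidable_eq decidable_not decidable_conj
  decidable_disj decidable_bex decidable_ball decidable_mem_set_decode

section \<open>Presentations of effective dynamical systems\<close>

instance recf :: countable
  by countable_datatype

text \<open>The invariant behind the counting. It depends on the abstract action alone; an infinite
  orbit counts as 0 by the convention for \<open>card\<close>.\<close>

definition orbit_sizes :: "('g, 'z) monoid_scheme \<Rightarrow> 'a set \<Rightarrow> ('g \<Rightarrow> 'a \<Rightarrow> 'a) \<Rightarrow> nat set" where
  "orbit_sizes \<Gamma> E \<phi> = (\<lambda>x. card (orbit \<Gamma> \<phi> x)) ` E"

lemma orbit_sizes_eq:
  assumes "group_action \<Gamma> E \<phi>" "bij_betw h E F"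
    and "\<And>g x. g \<in> carrier \<Gamma> \<Longrightarrow> x \<in> E \<Longrightarrow> h (\<phi> g x) = \<psi> g (h x)"
  shows "orbit_sizes \<Gamma> E \<phi> = orbit_sizes \<Gamma> F \<psi>"
proof -
  interpret group_action \<Gamma> E \<phi> by fact
  have card: "card (orbit \<Gamma> \<psi> (h x)) = card (orbit \<Gamma> \<phi> x)" if "x \<in> E" for x
  proof -
    have "orbit \<Gamma> \<psi> (h x) = h ` orbit \<Gamma> \<phi> x"
      using assms(3) that by (force simp: orbit_def)
    moreover have "orbit \<Gamma> \<phi> x \<subseteq> E"
      using element_image that by (auto simp: orbit_def)
    then have "inj_on h (orbit \<Gamma> \<phi> x)"
      using assms(2) by (auto simp: bij_betw_def intro: inj_on_subset)
    ultimately show ?thesis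
      by (simp add: card_image)
  qed
  have "orbit_sizes \<Gamma> F \<psi> = (\<lambda>x. card (orbit \<Gamma> \<psi> x)) ` h ` E"
    using assms(2) by (simp add: orbit_sizes_def bij_betw_def)
  then show ?thesis
    using card by (simp add: orbit_sizes_def image_image)
qed

section \<open>Comparing compact sets through basic balls\<close>

lemma mem_basic_ball:
  assumes "range s \<subseteq> mspace m"
  shows "x \<in> basic_ball m s (prod_encode (i, prod_encode (a, b))) \<longleftrightarrow>
    x \<in> mspace m \<and> mdist m (s i) x < real (Suc a) / real (Suc b)"
  using assms by (auto simp: basic_ball_def)

lemma openin_basic_ball: "openin (mtopology_of m) (basic_ball m s n)"
  by (auto simp: basic_ball_def mtopology_of_def mball_of_def Metric_space.openin_mball split: prod.splits)

lemma positive_fraction_between: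
  fixes u v :: real
  assumes "0 \<le> u" "u < v"
  obtains a b where "u < real (Suc a) / real (Suc b)" "real (Suc a) / real (Suc b) < v"
proof -
  obtain b where b: "inverse (real (Suc b)) < v - u"
    using reals_Archimedean[of "v - u"] assms by auto
  \<comment> \<open>\<open>Suc a\<close> is the first integer above \<open>u * Suc b\<close>, and it
    is positive, as a numerator of a radius must be.\<close>
  define a where "a = nat \<lfloor>u * real (Suc b)\<rfloor>"
  have a: "real a \<le> u * real (Suc b)" "u * real (Suc b) < real (Suc a)"
    using assms(1) unfolding a_def by (auto, linarith)
  have "real (Suc a) \<le> u * real (Suc b) + 1"
    using a(1) by simp
  also have "\<dots> < v * real (Suc b)"
    using b by (simp add: field_simps)
  finally show ?thesis
    using a(2) by (intro that[of a b]) (simp_all add: field_simps)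
qed

lemma dense_point_near:
  assumes "computable_metric_space m s" "x \<in> mspace m" "e > 0"
  obtains i where "mdist m (s i) x < e"
proof -
  have "x \<in> Abstract_Topology.closure_of (Metric_space.mtopology (mspace m) (mdist m)) (range s)"
    using assms by (simp add: mtopology_of_def computable_metric_space_def)
  then obtain i where "s i \<in> Metric_space.mball (mspace m) (mdist m) x e"
    using assms(3) by (auto simp: Metric_space.metric_closure_of)
  then show ?thesis
    by (intro that[of i]) (simp add: Metric_space.in_mball mdist_commute)
qed

text \<open>Compactness yields only this one-sided hypothesis on balls, which bounds every distance
  to \<open>x\<close> by the one to \<open>x'\<close>. The converse comes from density: a centre
  close to \<open>x'\<close> is then also close to \<open>x\<close>, and distances between centres
  agree.\<close>

lemma mdist_eq_of_basic_balls:
  assumes cms: "computable_metric_space m s" "computable_metric_space m' s'"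
    and dist: "\<And>i j. mdist m (s i) (s j) = mdist m' (s' i) (s' j)"
    and x: "x \<in> mspace m" "x' \<in> mspace m'"
    and balls: "\<And>n. x' \<in> basic_ball m' s' n \<Longrightarrow> x \<in> basic_ball m s n"
  shows "mdist m (s i) x = mdist m' (s' i) x'"
proof (rule antisym)
  have s: "range s \<subseteq> mspace m" "range s' \<subseteq> mspace m'"
    using cms by (auto simp: computable_metric_space_def)
  show le: "mdist m (s i) x \<le> mdist m' (s' i) x'" for i
  proof (rule ccontr)
    assume "\<not> mdist m (s i) x \<le> mdist m' (s' i) x'"
    then obtain a b where "mdist m' (s' i) x' < real (Suc a) / real (Suc b)"
        "real (Suc a) / real (Suc b) < mdist m (s i) x"
      using positive_fraction_between[of "mdist m' (s' i) x'" "mdist m (s i) x"] by auto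
    then show False
      using balls[of "prod_encode (i, prod_encode (a, b))"] x by (simp add: mem_basic_ball s)
  qed
  show "mdist m' (s' i) x' \<le> mdist m (s i) x"
  proof (rule field_le_epsilon)
    fix e :: real assume "e > 0"
    then obtain k where k: "mdist m' (s' k) x' < e / 2"
      using dense_point_near[OF cms(2) x(2), of "e / 2"] by auto
    have "mdist m' (s' i) x' \<le> mdist m' (s' i) (s' k) + mdist m' (s' k) x'"
      using s x by (intro mdist_triangle) auto
    moreover have "mdist m (s i) (s k) \<le> mdist m (s i) x + mdist m x (s k)"
      using s x by (intro mdist_triangle) auto
    ultimately show "mdist m' (s' i) x' \<le> mdist m (s i) x + e"
      using k le[of k] dist[of i k] by (simp add: mdist_commute)
  qed
qed

text \<open>If no point of \<open>K'\<close> matched \<open>x\<close>, then every point of \<open>K'\<close> would lie in a ball whose counterpart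
  omits \<open>x\<close>. Finitely many of these balls cover \<open>K'\<close>, so their counterparts cover \<open>K\<close> and \<open>x\<close>.\<close>

lemma matching_point:
  assumes cms: "computable_metric_space m s" "computable_metric_space m' s'"
    and dist: "\<And>i j. mdist m (s i) (s j) = mdist m' (s' i) (s' j)"
    and K: "K \<subseteq> mspace m" "compactin (mtopology_of m') K'"
    and cover: "\<And>I. finite I \<Longrightarrow> K' \<subseteq> (\<Union>n\<in>I. basic_ball m' s' n) \<Longrightarrow> K \<subseteq> (\<Union>n\<in>I. basic_ball m s n)"
    and x: "x \<in> K"
  shows "\<exists>x'\<in>K'. \<forall>n. x \<in> basic_ball m s n \<longleftrightarrow> x' \<in> basic_ball m' s' n"
proof -
  have s: "range s \<subseteq> mspace m" "range s' \<subseteq> mspace m'"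
    using cms by (auto simp: computable_metric_space_def)
  have K': "K' \<subseteq> mspace m'"
    using compactin_subset_topspace[OF K(2)] by simp
  define N where "N = {n. x \<notin> basic_ball m s n}"
  have "\<not> K' \<subseteq> \<Union> (basic_ball m' s' ` N)"
  proof
    assume "K' \<subseteq> \<Union> (basic_ball m' s' ` N)"
    then obtain \<F> where "finite \<F>" "\<F> \<subseteq> basic_ball m' s' ` N" "K' \<subseteq> \<Union> \<F>"
      using K(2) openin_basic_ball[of m' s'] unfolding compactin_def by (metis imageE)
    then obtain I where "finite I" "I \<subseteq> N" "K' \<subseteq> (\<Union>n\<in>I. basic_ball m' s' n)"
      by (metis finite_subset_image)
    then show False
      using cover[of I] x by (auto simp: N_def)
  qed
  then obtain x' where x': "x' \<in> K'" "\<And>n. x' \<in> basic_ball m' s' n \<Longrightarrow> x \<in> basic_ball m s n"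
    by (auto simp: N_def)
  have xM: "x \<in> mspace m" "x' \<in> mspace m'"
    using x x' K K' by auto
  have "mdist m (s i) x = mdist m' (s' i) x'" for i
    by (rule mdist_eq_of_basic_balls[OF cms dist xM x'(2)])
  then have "x \<in> basic_ball m s n \<longleftrightarrow> x' \<in> basic_ball m' s' n" for n
    using s xM by (auto simp: basic_ball_def split: prod.splits)
  then show ?thesis
    using x'(1) by blast
qed

text \<open>Points are matched in both directions; since basic balls separate points, a match is
  unique, which makes the matching injective and onto.\<close>

lemma ball_preserving_bijection:
  assumes cms: "computable_metric_space m s" "computable_metric_space m' s'"
    and dist: "\<And>i j. mdist m (s i) (s j) = mdist m' (s' i) (s' j)"
    and K: "compactin (mtopology_of m) K" "compactin (mtopology_of m') K'"
    and cover: "\<And>I. finite I \<Longrightarrow>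
      K \<subseteq> (\<Union>n\<in>I. basic_ball m s n) \<longleftrightarrow> K' \<subseteq> (\<Union>n\<in>I. basic_ball m' s' n)"
  obtains h where "bij_betw h K K'"
    "\<And>x n. x \<in> K \<Longrightarrow> x \<in> basic_ball m s n \<longleftrightarrow> h x \<in> basic_ball m' s' n"
proof -
  have KM: "K \<subseteq> mspace m" "K' \<subseteq> mspace m'"
    using K compactin_subset_topspace by fastforce+
  have "\<forall>x\<in>K. \<exists>x'\<in>K'. \<forall>n. x \<in> basic_ball m s n \<longleftrightarrow> x' \<in> basic_ball m' s' n"
    using matching_point[OF cms dist KM(1) K(2)] cover by blast
  then obtain h where h: "\<And>x. x \<in> K \<Longrightarrow> h x \<in> K'"
    "\<And>x n. x \<in> K \<Longrightarrow> x \<in> basic_ball m s n \<longleftrightarrow> h x \<in> basic_ball m' s' n"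
    by metis
  have "inj_on h K"
    using h(2) KM(1) basic_balls_separate_points[OF cms(1)] unfolding inj_on_def by (metis subsetD)
  moreover have "x' \<in> h ` K" if x': "x' \<in> K'" for x'
  proof -
    obtain x where x: "x \<in> K" "\<And>n. x' \<in> basic_ball m' s' n \<longleftrightarrow> x \<in> basic_ball m s n"
      using matching_point[OF cms(2,1) dist[symmetric] KM(2) K(1) _ x'] cover by blast
    then have "x' = h x"
      using h x' KM(2) basic_balls_separate_points[OF cms(2)] by (metis subsetD)
    then show ?thesis
      using x by blast
  qed
  ultimately have "bij_betw h K K'"
    using h(1) by (auto simp: bij_betw_def)
  then show ?thesis
    using h(2) that by blast
qed

text \<open>This and the next two predicates expose the programs hidden under existential
  quantifiers, so that two systems can be said to share them.\<close>

definition distance_program :: "'c metric \<Rightarrow> (nat \<Rightarrow> 'c) \<Rightarrow> recf \<Rightarrow> bool" where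
  "distance_program m s p \<longleftrightarrow> (\<forall>i j n. \<exists>r. run p [i, j, n] = Some r \<and>
     \<bar>mdist m (s i) (s j) - real_of_rat (nat_to_rat_surj r)\<bar> \<le> (1/2) ^ n)"

definition cover_program :: "'c metric \<Rightarrow> (nat \<Rightarrow> 'c) \<Rightarrow> 'c set \<Rightarrow> recf \<Rightarrow> bool" where
  "cover_program m s K q \<longleftrightarrow> (\<forall>I. finite I \<longrightarrow>
     (run q [set_encode I] \<noteq> None \<longleftrightarrow> K \<subseteq> (\<Union>n\<in>I. basic_ball m s n)))"

definition preimage_program ::
  "'c metric \<Rightarrow> (nat \<Rightarrow> 'c) \<Rightarrow> 'c set \<Rightarrow> ('c \<Rightarrow> 'c) \<Rightarrow> recf \<Rightarrow> bool" where
  "preimage_program m s K f r \<longleftrightarrow>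
     (\<forall>j. {y \<in> K. f y \<in> basic_ball m s j} =
        (\<Union>n\<in>{n. \<exists>k. run r [j, k] = Some n}. basic_ball m s n) \<inter> K)"

text \<open>The first component is finite data, hence countably many values over a countable group.
  Continuity of the action is left out because orbit sizes do not see it.\<close>

definition presents ::
  "recf \<times> recf \<times> ('g \<times> recf) list \<Rightarrow> ('g, 'z) monoid_scheme \<Rightarrow> 'c metric \<Rightarrow> (nat \<Rightarrow> 'c) \<Rightarrow>
   'c set \<Rightarrow> ('g \<Rightarrow> 'c \<Rightarrow> 'c) \<Rightarrow> bool" where
  "presents = (\<lambda>(p, q, gens) \<Gamma> m s K \<alpha>.
     computable_metric_space m s \<and> distance_program m s p \<and>
     compactin (mtopology_of m) K \<and> cover_program m s K q \<and> group_action \<Gamma> K \<alpha> \<and>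
     fst ` set gens \<subseteq> carrier \<Gamma> \<and> generate \<Gamma> (fst ` set gens) = carrier \<Gamma> \<and>
     (\<forall>(g, r)\<in>set gens. preimage_program m s K (\<alpha> g) r))"

text \<open>Shared distance and cover programs give a bijection respecting all basic balls; shared
  preimage programs make it equivariant for the generators, hence for the group they
  generate.\<close>

lemma presents_orbit_sizes_eq:
  assumes 1: "presents c \<Gamma> m s K \<alpha>" and 2: "presents c \<Gamma> m' s' K' \<beta>"
  shows "orbit_sizes \<Gamma> K \<alpha> = orbit_sizes \<Gamma> K' \<beta>"
proof -
  obtain p q gens where c: "c = (p, q, gens)"
    by (cases c)
  have cms: "computable_metric_space m s" "computable_metric_space m' s'"
    and K: "compactin (mtopology_of m) K" "compactin (mtopology_of m') K'"
    and act: "group_action \<Gamma> K \<alpha>" "group_action \<Gamma> K' \<beta>"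
    and p: "distance_program m s p" "distance_program m' s' p"
    and q: "cover_program m s K q" "cover_program m' s' K' q"
    and r: "\<forall>(g, r)\<in>set gens. preimage_program m s K (\<alpha> g) r"
      "\<forall>(g, r)\<in>set gens. preimage_program m' s' K' (\<beta> g) r"
    and gens: "fst ` set gens \<subseteq> carrier \<Gamma>" "generate \<Gamma> (fst ` set gens) = carrier \<Gamma>"
    using 1 2 by (simp_all add: presents_def c)
  have dist: "mdist m (s i) (s j) = mdist m' (s' i) (s' j)" for i j
  proof -
    have close: "\<bar>mdist m (s i) (s j) - mdist m' (s' i) (s' j)\<bar> \<le> 2 * (1/2) ^ n" for n
    proof -
      obtain r where "run p [i, j, n] = Some r"
          "\<bar>mdist m (s i) (s j) - real_of_rat (nat_to_rat_surj r)\<bar> \<le> (1/2) ^ n"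
        using p(1) unfolding distance_program_def by blast
      moreover from this(1)
      have "\<bar>mdist m' (s' i) (s' j) - real_of_rat (nat_to_rat_surj r)\<bar> \<le> (1/2) ^ n"
        using p(2) unfolding distance_program_def by (metis option.inject)
      ultimately show ?thesis
        by linarith
    qed
    \<comment> \<open>Both distances are approximated by the same outputs, at every precision, so
      they coincide.\<close>
    have "(\<lambda>n. 2 * (1/2 :: real) ^ n) \<longlonglongrightarrow> 2 * 0"
      by (intro tendsto_intros LIMSEQ_power_zero) simp
    then have "\<bar>mdist m (s i) (s j) - mdist m' (s' i) (s' j)\<bar> \<le> 2 * 0"
      by (rule LIMSEQ_le_const) (use close in blast)
    then show ?thesis
      by simp
  qed
  have cover: "K \<subseteq> (\<Union>n\<in>I. basic_ball m s n) \<longleftrightarrow> K' \<subseteq> (\<Union>n\<in>I. basic_ball m' s' n)"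
    if "finite I" for I
    using q that by (simp add: cover_program_def)
  obtain h where h: "bij_betw h K K'"
    "\<And>x n. x \<in> K \<Longrightarrow> x \<in> basic_ball m s n \<longleftrightarrow> h x \<in> basic_ball m' s' n"
    using ball_preserving_bijection[OF cms dist K cover] by blast
  interpret a: group_action \<Gamma> K \<alpha> by (rule act)
  interpret b: group_action \<Gamma> K' \<beta> by (rule act)
  interpret group \<Gamma>
    using act(1) by (simp add: group_action_def group_hom_def)
  have hK: "h x \<in> K'" if "x \<in> K" for x
    using h(1) that by (auto simp: bij_betw_def)
  have KM: "K' \<subseteq> mspace m'"
    using K compactin_subset_topspace by fastforce
  have gen: "h (\<alpha> g x) = \<beta> g (h x)" if g: "g \<in> fst ` set gens" and x: "x \<in> K" for g x
  proof (rule ccontr)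
    assume ne: "h (\<alpha> g x) \<noteq> \<beta> g (h x)"
    have gG: "g \<in> carrier \<Gamma>"
      using g gens by blast
    obtain t where t: "(g, t) \<in> set gens"
      using g by auto
    have "h (\<alpha> g x) \<in> K'" "\<beta> g (h x) \<in> K'"
      using a.element_image b.element_image gG x hK by blast+
    then obtain j where j: "h (\<alpha> g x) \<in> basic_ball m' s' j" "\<beta> g (h x) \<notin> basic_ball m' s' j"
      using basic_balls_separate_points[OF cms(2)] ne KM by blast
    \<comment> \<open>Both preimages of ball \<open>j\<close> are cut out by the same enumerated
      indices, and \<open>h\<close> respects every indexed ball; so \<open>j\<close> cannot
      distinguish the two images.\<close>
    have "{y \<in> K. \<alpha> g y \<in> basic_ball m s j} =
        (\<Union>n\<in>{n. \<exists>k. run t [j, k] = Some n}. basic_ball m s n) \<inter> K"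
      using r(1) t unfolding preimage_program_def by blast
    moreover have "{y \<in> K'. \<beta> g y \<in> basic_ball m' s' j} =
        (\<Union>n\<in>{n. \<exists>k. run t [j, k] = Some n}. basic_ball m' s' n) \<inter> K'"
      using r(2) t unfolding preimage_program_def by blast
    ultimately have "\<alpha> g x \<in> basic_ball m s j \<longleftrightarrow> \<beta> g (h x) \<in> basic_ball m' s' j"
      using x hK[OF x] h(2)[OF x] by (simp add: set_eq_iff) blast
    then show False
      using j h(2) a.element_image gG x by blast
  qed
  have "\<forall>x\<in>K. h (\<alpha> g x) = \<beta> g (h x)" if "g \<in> generate \<Gamma> (fst ` set gens)" for g
    using that
  proof induction
    case one
    show ?case
      using a.id_eq_one b.id_eq_one hK by (metis restrict_apply')
  next
    case (incl g)
    then show ?case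
      using gen by blast
  next
    case (inv g)
    then have gG: "g \<in> carrier \<Gamma>"
      using gens by blast
    show ?case
    proof
      fix x assume x: "x \<in> K"
      \<comment> \<open>Inverses of generators carry no program; equivariance of \<open>g\<close>
        itself is used at the preimage \<open>y\<close> of \<open>x\<close>.\<close>
      define y where "y = \<alpha> (inv\<^bsub>\<Gamma>\<^esub> g) x"
      have y: "y \<in> K"
        using a.element_image[of "inv\<^bsub>\<Gamma>\<^esub> g" x] gG x by (simp add: y_def)
      have "\<alpha> g y = x"
        using a.orbit_sym_aux[of "inv\<^bsub>\<Gamma>\<^esub> g" x y] gG x by (simp add: y_def)
      then have "\<beta> g (h y) = h x"
        using gen[OF inv y] by simp
      then show "h (\<alpha> (inv\<^bsub>\<Gamma>\<^esub> g) x) = \<beta> (inv\<^bsub>\<Gamma>\<^esub> g) (h x)"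
        using b.orbit_sym_aux[OF gG hK[OF y]] by (simp add: y_def)
    qed
  next
    case (eng g1 g2)
    then have g: "g1 \<in> carrier \<Gamma>" "g2 \<in> carrier \<Gamma>"
      using gens by blast+
    show ?case
    proof
      fix x assume x: "x \<in> K"
      have "\<alpha> g2 x \<in> K"
        using a.element_image g x by blast
      then show "h (\<alpha> (g1 \<otimes>\<^bsub>\<Gamma>\<^esub> g2) x) = \<beta> (g1 \<otimes>\<^bsub>\<Gamma>\<^esub> g2) (h x)"
        using eng.IH x
        by (simp add: a.composition_rule[OF x g] b.composition_rule[OF hK[OF x] g])
    qed
  qed
  then show ?thesis
    using orbit_sizes_eq[OF act(1) h(1)] gens(2) by blast
qed

text \<open>Only bijectivity and equivariance of the conjugacy are used to carry the orbit sizes to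
  the model, so its possible uncomputability does no harm.\<close>

lemma effective_dynamical_system_presents:
  assumes act: "homeomorphism_action \<Gamma> X \<phi>" and eds: "effective_dynamical_system \<Gamma> X \<phi>"
  shows "\<exists>c (m :: (nat \<Rightarrow> nat) metric) s K \<alpha>.
    presents c \<Gamma> m s K \<alpha> \<and> orbit_sizes \<Gamma> K \<alpha> = orbit_sizes \<Gamma> (topspace X) \<phi>"
proof -
  obtain m :: "(nat \<Rightarrow> nat) metric" and s K \<alpha> where
    cms: "computable_metric_space m s" and K: "recursively_compact m s K"
    and ca: "computable_action \<Gamma> m s K \<alpha>"
    and conj: "topologically_conjugate \<Gamma> X \<phi> (subtopology (mtopology_of m) K) \<alpha>"
    using eds unfolding effective_dynamical_system_def by blast
  have top: "topspace (subtopology (mtopology_of m) K) = K"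
    using K compactin_subset_topspace[of "mtopology_of m" K] by (auto simp: recursively_compact_def)
  obtain f where f: "topological_factor_map \<Gamma> X \<phi> (subtopology (mtopology_of m) K) \<alpha> f"
    "homeomorphic_map X (subtopology (mtopology_of m) K) f"
    using conj unfolding topologically_conjugate_def by blast
  have "bij_betw f (topspace X) K"
    using f(2) top by (metis bij_betw_def homeomorphic_imp_injective_map homeomorphic_imp_surjective_map)
  then have sizes: "orbit_sizes \<Gamma> (topspace X) \<phi> = orbit_sizes \<Gamma> K \<alpha>"
    using act f(1) by (intro orbit_sizes_eq)
      (auto simp: homeomorphism_action_def topological_factor_map_def)
  obtain p where p: "distance_program m s p"
    using cms unfolding computable_metric_space_def distance_program_def by blast
  obtain q where q: "cover_program m s K q"
    using K unfolding recursively_compact_def cover_program_def by blast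
  obtain S where S: "finite S" "S \<subseteq> carrier \<Gamma>" "generate \<Gamma> S = carrier \<Gamma>"
    "\<And>g. g \<in> S \<Longrightarrow> computable_map_on m s K m s (\<alpha> g)"
    using ca unfolding computable_action_def by blast
  have "\<exists>r. preimage_program m s K (\<alpha> g) r" if "g \<in> S" for g
    using S(4)[OF that] unfolding computable_map_on_def preimage_program_def by blast
  then obtain P where P: "\<And>g. g \<in> S \<Longrightarrow> preimage_program m s K (\<alpha> g) (P g)"
    by metis
  obtain gs where gs: "set gs = S"
    using finite_list[OF S(1)] by blast
  have "presents (p, q, map (\<lambda>g. (g, P g)) gs) \<Gamma> m s K \<alpha>"
    unfolding presents_def prod.case
  proof (intro conjI)
    show "compactin (mtopology_of m) K"
      using K by (simp add: recursively_compact_def)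
    show "group_action \<Gamma> K \<alpha>"
      using ca top by (simp add: computable_action_def homeomorphism_action_def)
    show "\<forall>(g, r)\<in>set (map (\<lambda>g. (g, P g)) gs). preimage_program m s K (\<alpha> g) r"
      using P gs by auto
  qed (use cms p q S gs in \<open>simp_all add: image_image\<close>)
  then show ?thesis
    using sizes by metis
qed

section \<open>Cycles converging to a fixed point\<close>

text \<open>A number \<open>n\<close> is regarded as the point at position \<open>pos n\<close> of a cycle of length \<open>cyc n + 1\<close>. The
  cycle with index \<open>c\<close> is \<open>{triangle c..triangle c + c}\<close>, and \<open>0\<close> is the fixed point in the limit.\<close>

definition cyc :: "nat \<Rightarrow> nat" where
  "cyc n = fst (prod_decode n) + snd (prod_decode n)"

definition pos :: "nat \<Rightarrow> nat" where
  "pos n = fst (prod_decode n)"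

lemma triangle_cyc_pos: "triangle (cyc n) + pos n = n"
  using prod_decode_inverse[of n] unfolding prod_encode_def cyc_def pos_def
  by (simp add: case_prod_unfold)

lemma pos_le_cyc: "pos n \<le> cyc n"
  by (simp add: cyc_def pos_def)

lemma prod_decode_triangle: "p \<le> c \<Longrightarrow> prod_decode (triangle c + p) = (p, c - p)"
  using prod_encode_inverse[of "(p, c - p)"] by (simp add: prod_encode_def)

lemma cyc_triangle: "p \<le> c \<Longrightarrow> cyc (triangle c + p) = c"
  and pos_triangle: "p \<le> c \<Longrightarrow> pos (triangle c + p) = p"
  by (simp_all add: cyc_def pos_def prod_decode_triangle)

lemma cyc_0 [simp]: "cyc 0 = 0"
  using cyc_triangle[of 0 0] by simp

lemma cyc_eq_0_iff: "cyc n = 0 \<longleftrightarrow> n = 0"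
  using triangle_cyc_pos[of n] pos_le_cyc[of n] by auto

lemma triangle_mono: "a \<le> b \<Longrightarrow> triangle a \<le> triangle b"
  by (rule lift_Suc_mono_le[of triangle]) auto

lemma less_triangle_if_cyc_le: "cyc n \<le> c \<Longrightarrow> n < triangle (Suc c)"
  using triangle_cyc_pos[of n] pos_le_cyc[of n] triangle_mono[of "cyc n" c] by simp

section \<open>Rotations of the cycles\<close>

definition rot :: "int \<Rightarrow> nat \<Rightarrow> nat" where
  "rot z n = triangle (cyc n) + nat ((int (pos n) + z) mod (int (cyc n) + 1))"

lemma rot_bound: "nat ((int (pos n) + z) mod (int (cyc n) + 1)) \<le> cyc n"
  using pos_mod_bound[of "int (cyc n) + 1" "int (pos n) + z"] by linarith

lemma cyc_rot [simp]: "cyc (rot z n) = cyc n"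
  unfolding rot_def by (rule cyc_triangle[OF rot_bound])

lemma pos_rot: "pos (rot z n) = nat ((int (pos n) + z) mod (int (cyc n) + 1))"
  unfolding rot_def by (rule pos_triangle[OF rot_bound])

lemma rot_rot: "rot a (rot b n) = rot (a + b) n"
  by (simp add: rot_def[of a] rot_def[of "a + b"] pos_rot mod_simps ac_simps)

lemma rot_zero [simp]: "rot 0 n = n"
  using pos_le_cyc[of n] triangle_cyc_pos[of n] by (simp add: rot_def)

lemma rot_inverse [simp]: "rot z (rot (- z) n) = n" "rot (- z) (rot z n) = n"
  by (simp_all add: rot_rot)

lemma rot_eq_iff: "rot z m = rot z n \<longleftrightarrow> m = n"
  by (metis rot_inverse(2))

text \<open>A form free of integers, from which computability of the generator is read off.\<close>

lemma rot_one: "rot 1 n = triangle (cyc n) + (if pos n = cyc n then 0 else Suc (pos n))"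
  using pos_le_cyc[of n] by (auto simp: rot_def nat_add_distrib mod_pos_pos_trivial)

lemma range_rot: "range (\<lambda>z. rot z n) = (\<lambda>p. triangle (cyc n) + p) ` {..cyc n}"
proof
  show "range (\<lambda>z. rot z n) \<subseteq> (\<lambda>p. triangle (cyc n) + p) ` {..cyc n}"
    using rot_bound by (auto simp: rot_def)
  show "(\<lambda>p. triangle (cyc n) + p) ` {..cyc n} \<subseteq> range (\<lambda>z. rot z n)"
  proof clarify
    fix p assume "p \<le> cyc n"
    then have "rot (int p - int (pos n)) n = triangle (cyc n) + p"
      by (simp add: rot_def)
    then show "triangle (cyc n) + p \<in> range (\<lambda>z. rot z n)"
      by (metis rangeI)
  qed
qed

text \<open>The convention \<open>1 / 0 = 0\<close> makes \<open>1 / cyc n\<close> the distance from \<open>n\<close> to the fixed point \<open>0\<close>.\<close>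

definition cycle_dist :: "nat \<Rightarrow> nat \<Rightarrow> real" where
  "cycle_dist m n = (if m = n then 0 else max (1 / real (cyc m)) (1 / real (cyc n)))"

text \<open>The distance depends only on equality and on the cycle indices, both invariant under
  rotation; hence the action is isometric.\<close>

lemma cycle_dist_rot: "cycle_dist (rot z m) (rot z n) = cycle_dist m n"
  by (simp add: cycle_dist_def rot_eq_iff)

text \<open>Constant functions embed the naturals into the point type used for metric models. The
  shift by \<open>Suc\<close> reserves index 0 for the fixed point, which is thus present for every
  \<open>A\<close>.\<close>

definition cycle_points :: "nat set \<Rightarrow> (nat \<Rightarrow> nat) set" where
  "cycle_points A = {\<lambda>_. n | n. cyc n \<in> insert 0 (Suc ` A)}"

definition cycle_metric :: "nat set \<Rightarrow> (nat \<Rightarrow> nat) metric" where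
  "cycle_metric A = metric (cycle_points A, \<lambda>x y. cycle_dist (x 0) (y 0))"

lemma const_mem_cycle_points [simp]: "(\<lambda>_. n) \<in> cycle_points A \<longleftrightarrow> cyc n \<in> insert 0 (Suc ` A)"
  unfolding cycle_points_def by (auto dest: fun_cong)

lemma cycle_pointsE:
  assumes "x \<in> cycle_points A"
  obtains n where "x = (\<lambda>_. n)" "cyc n \<in> insert 0 (Suc ` A)"
  using assms unfolding cycle_points_def by auto

lemma const_mem_cycle_points_UNIV [simp]: "(\<lambda>_. n) \<in> cycle_points UNIV"
  by (cases "cyc n") auto

lemma Metric_space_cycle: "Metric_space (cycle_points A) (\<lambda>x y. cycle_dist (x 0) (y 0))"
proof
  show "0 \<le> cycle_dist (x 0) (y 0)" for x y :: "nat \<Rightarrow> nat"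
    by (simp add: cycle_dist_def le_max_iff_disj)
  show "cycle_dist (x 0) (y 0) = cycle_dist (y 0) (x 0)" for x y :: "nat \<Rightarrow> nat"
    by (simp add: cycle_dist_def max.commute)
  show "cycle_dist (x 0) (y 0) = 0 \<longleftrightarrow> x = y"
    if x: "x \<in> cycle_points A" and y: "y \<in> cycle_points A" for x y
  proof
    assume eq: "cycle_dist (x 0) (y 0) = 0"
    have "x 0 = y 0"
    proof (rule ccontr)
      assume ne: "x 0 \<noteq> y 0"
      \<comment> \<open>Only the point 0 has reciprocal index 0, so one of two distinct points
        contributes a positive value.\<close>
      then have "max (1 / real (cyc (x 0))) (1 / real (cyc (y 0))) > 0"
        using cyc_eq_0_iff[of "x 0"] cyc_eq_0_iff[of "y 0"] by (auto simp: less_max_iff_disj)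
      then show False
        using eq ne by (simp add: cycle_dist_def)
    qed
    then show "x = y"
      using x y by (auto elim!: cycle_pointsE)
  qed (simp add: cycle_dist_def)
  show "cycle_dist (x 0) (z 0) \<le> cycle_dist (x 0) (y 0) + cycle_dist (y 0) (z 0)"
    for x y z :: "nat \<Rightarrow> nat"
  proof -
    define e where "e n = 1 / real (cyc n)" for n
    have "0 \<le> e n" for n
      by (simp add: e_def)
    from this[of "x 0"] this[of "y 0"] this[of "z 0"] show ?thesis
      unfolding cycle_dist_def e_def[symmetric] by (auto simp: max_def)
  qed
qed

lemma mspace_cycle_metric [simp]: "mspace (cycle_metric A) = cycle_points A"
  and mdist_cycle_metric [simp]: "mdist (cycle_metric A) = (\<lambda>x y. cycle_dist (x 0) (y 0))"
  using Metric_space_cycle[of A]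
  by (simp_all add: cycle_metric_def Metric_space.mspace_metric Metric_space.mdist_metric)

section \<open>Topology of the space of cycles\<close>

abbreviation cycle_topology :: "nat set \<Rightarrow> (nat \<Rightarrow> nat) topology" where
  "cycle_topology A \<equiv> mtopology_of (cycle_metric A)"

lemma openin_cycle_topology:
  "openin (cycle_topology A) U \<longleftrightarrow> U \<subseteq> cycle_points A \<and>
    (\<forall>x\<in>U. \<exists>r>0. \<forall>y\<in>cycle_points A. cycle_dist (x 0) (y 0) < r \<longrightarrow> y \<in> U)"
proof -
  have "Metric_space.mball (cycle_points A) (\<lambda>x y. cycle_dist (x 0) (y 0)) x r \<subseteq> U \<longleftrightarrow>
      (\<forall>y\<in>cycle_points A. cycle_dist (x 0) (y 0) < r \<longrightarrow> y \<in> U)"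
    if "x \<in> cycle_points A" for x r
    using that by (auto simp: Metric_space.in_mball[OF Metric_space_cycle])
  then show ?thesis
    unfolding mtopology_of_def mspace_cycle_metric mdist_cycle_metric
      Metric_space.openin_mtopology[OF Metric_space_cycle]
    by (meson subsetD)
qed

text \<open>A point \<open>n\<close> other than the limit is at distance at least
  \<open>1 / cyc n\<close> from all others, so it is isolated.\<close>

lemma openin_cycle_topology_if_isolated:
  assumes "U \<subseteq> cycle_points A" "(\<lambda>_. 0) \<notin> U"
  shows "openin (cycle_topology A) U"
  unfolding openin_cycle_topology
proof (intro conjI ballI)
  fix x assume x: "x \<in> U"
  then have "x \<in> cycle_points A"
    using assms(1) by blast
  then obtain n where n: "x = (\<lambda>_. n)"
    by (rule cycle_pointsE)
  have "n \<noteq> 0"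
    using assms(2) x n by (cases "n = 0") auto
  have "y \<in> U" if "y \<in> cycle_points A" "cycle_dist (x 0) (y 0) < 1 / real (cyc n)" for y
  proof -
    obtain k where k: "y = (\<lambda>_. k)"
      using \<open>y \<in> cycle_points A\<close> by (rule cycle_pointsE)
    have "cycle_dist n k < 1 / real (cyc n)"
      using that(2) by (simp add: n k)
    then have "n = k"
      by (auto simp: cycle_dist_def split: if_splits)
    then show ?thesis
      using x n k by simp
  qed
  then show "\<exists>r>0. \<forall>y\<in>cycle_points A. cycle_dist (x 0) (y 0) < r \<longrightarrow> y \<in> U"
    using \<open>n \<noteq> 0\<close> cyc_eq_0_iff[of n] by (intro exI[of _ "1 / real (cyc n)"]) simp
qed (use assms in auto)

text \<open>Points at distance at least \<open>r\<close> from the limit have bounded cycle index,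
  and only finitely many numbers do.\<close>

lemma finite_complement_of_limit_neighbourhood:
  assumes "openin (cycle_topology A) U" "(\<lambda>_. 0) \<in> U"
  shows "finite (cycle_points A - U)"
proof -
  obtain r where r: "r > 0" "\<And>y. y \<in> cycle_points A \<Longrightarrow> cycle_dist 0 (y 0) < r \<Longrightarrow> y \<in> U"
    using assms unfolding openin_cycle_topology by meson
  obtain c where c: "inverse (real (Suc c)) < r"
    using reals_Archimedean r(1) by blast
  have "x \<in> (\<lambda>n _. n) ` {..<triangle (Suc c)}" if x: "x \<in> cycle_points A - U" for x
  proof -
    obtain n where n: "x = (\<lambda>_. n)"
      using x by (auto elim: cycle_pointsE)
    have "\<not> cycle_dist 0 n < r"
      using r(2)[of x] x n by auto
    then have "r \<le> 1 / real (cyc n)"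
      using r(1) by (auto simp: cycle_dist_def split: if_splits)
    then have "inverse (real (Suc c)) < 1 / real (cyc n)"
      using c by linarith
    then have "cyc n \<le> c"
      by (cases "cyc n = 0") (auto simp: field_simps)
    then show ?thesis
      using n less_triangle_if_cyc_le by auto
  qed
  then show ?thesis
    by (meson finite_imageI finite_lessThan finite_subset subsetI)
qed

lemma compact_space_cycle: "compact_space (cycle_topology A)"
  unfolding compact_space_def compactin_def
proof (intro conjI allI impI)
  fix \<U> assume "(\<forall>U\<in>\<U>. openin (cycle_topology A) U) \<and>
    topspace (cycle_topology A) \<subseteq> \<Union> \<U>"
  then have op: "\<And>U. U \<in> \<U> \<Longrightarrow> openin (cycle_topology A) U"
    and cov: "cycle_points A \<subseteq> \<Union> \<U>"
    by simp_all
  have "(\<lambda>_. 0) \<in> cycle_points A"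
    by simp
  then obtain U where U: "U \<in> \<U>" "(\<lambda>_. 0) \<in> U"
    using cov by blast
  have fin: "finite (cycle_points A - U)"
    by (rule finite_complement_of_limit_neighbourhood[OF op[OF U(1)] U(2)])
  have "\<forall>x\<in>cycle_points A - U. \<exists>W. W \<in> \<U> \<and> x \<in> W"
    using cov by blast
  from bchoice[OF this] obtain f where f: "\<forall>x\<in>cycle_points A - U. f x \<in> \<U> \<and> x \<in> f x"
    by blast
  have "finite (insert U (f ` (cycle_points A - U)))"
    using fin by simp
  moreover have "insert U (f ` (cycle_points A - U)) \<subseteq> \<U>"
    using f U by blast
  moreover have "cycle_points A \<subseteq> \<Union> (insert U (f ` (cycle_points A - U)))"
    using f by blast
  ultimately show "\<exists>\<F>. finite \<F> \<and> \<F> \<subseteq> \<U> \<and> topspace (cycle_topology A) \<subseteq> \<Union> \<F>"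
    by (metis topspace_mtopology_of mspace_cycle_metric)
qed simp

text \<open>An open set containing the limit is closed, because its complement consists of isolated
  points; any other open set is a union of clopen singletons.\<close>

lemma zero_dimensional_cycle: "zero_dimensional (cycle_topology A)"
proof -
  let ?X = "cycle_topology A"
  have hausdorff: "Hausdorff_space ?X"
    unfolding mtopology_of_def
    by (rule Metric_space.Hausdorff_space_mtopology[OF Metric_space_mspace_mdist])
  have "\<exists>U V. openin ?X U \<and> (closedin ?X V \<and> openin ?X V) \<and> x \<in> U \<and> U \<subseteq> V \<and> V \<subseteq> W"
    if W: "openin ?X W" and x: "x \<in> W" for W x
  proof (cases "(\<lambda>_. 0) \<in> W")
    case True
    have "openin ?X (topspace ?X - W)"
      using True by (intro openin_cycle_topology_if_isolated) auto
    then have "closedin ?X W"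
      using openin_subset[OF W] by (simp add: closedin_def)
    then show ?thesis
      using W x by blast
  next
    case False
    have xX: "x \<in> cycle_points A"
      using openin_subset[OF W] x by auto
    then have "openin ?X {x}"
      using False x by (intro openin_cycle_topology_if_isolated) auto
    moreover have "closedin ?X {x}"
      using xX hausdorff by (intro closedin_Hausdorff_singleton) simp_all
    ultimately show ?thesis
      using x by blast
  qed
  then have "?X dim_le 0"
    by (simp add: dimension_le_0_neighbourhood_base_of_clopen neighbourhood_base_of)
  moreover have "metrizable_space ?X"
    unfolding mtopology_of_def
    by (rule Metric_space.metrizable_space_mtopology[OF Metric_space_mspace_mdist])
  moreover have "(\<lambda>_. 0) \<in> topspace ?X"
    by simp
  ultimately show ?thesis
    using compact_space_cycle[of A] unfolding zero_dimensional_def by blast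
qed

text \<open>The integers carried over to \<open>nat\<close>, the element type in the final
  statement.\<close>

definition int_group :: "nat monoid" where
  "int_group = \<lparr>carrier = UNIV, mult = (\<lambda>a b. int_encode (int_decode a + int_decode b)),
    one = int_encode 0\<rparr>"

lemma int_group_simps [simp]:
  "carrier int_group = UNIV"
  "a \<otimes>\<^bsub>int_group\<^esub> b = int_encode (int_decode a + int_decode b)"
  "\<one>\<^bsub>int_group\<^esub> = int_encode 0"
  by (simp_all add: int_group_def)

lemma group_int_group: "group int_group"
proof (rule groupI)
  show "\<exists>y\<in>carrier int_group. y \<otimes>\<^bsub>int_group\<^esub> x = \<one>\<^bsub>int_group\<^esub>" for x
    by (rule bexI[of _ "int_encode (- int_decode x)"]) simp_all
qed (simp_all add: ac_simps)

lemma inv_int_group: "inv\<^bsub>int_group\<^esub> x = int_encode (- int_decode x)"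
  by (rule group.inv_equality[OF group_int_group]) simp_all

lemma generate_int_group: "generate int_group {int_encode 1} = carrier int_group"
proof -
  have one: "int_encode 1 \<in> generate int_group {int_encode 1}"
    by (rule generate.incl) simp
  have minus_one: "int_encode (- 1) \<in> generate int_group {int_encode 1}"
    using generate.inv[of "int_encode 1" "{int_encode 1}" int_group] by (simp add: inv_int_group)
  have "int_encode z \<in> generate int_group {int_encode 1}" for z
  proof (induction z rule: int_induct[where k = 0])
    case base
    show ?case
      using generate.one[of int_group] by simp
  next
    case (step1 z)
    then show ?case
      using generate.eng[OF step1(2) one] by simp
  next
    case (step2 z)
    then show ?case
      using generate.eng[OF step2(2) minus_one] by simp
  qed
  then have "x \<in> generate int_group {int_encode 1}" for x
    by (metis int_decode_inverse)
  then show ?thesis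
    by auto
qed

lemma finitely_generated_int_group: "finitely_generated_group int_group"
  unfolding finitely_generated_group_def
  using group_int_group generate_int_group by (intro conjI exI[of _ "{int_encode 1}"]) auto

text \<open>The restriction is forced by \<open>BijGroup\<close>, whose elements are extensional
  functions.\<close>

definition cycle_action :: "nat set \<Rightarrow> nat \<Rightarrow> (nat \<Rightarrow> nat) \<Rightarrow> nat \<Rightarrow> nat" where
  "cycle_action A g = (\<lambda>x\<in>cycle_points A. \<lambda>_. rot (int_decode g) (x 0))"

lemma cycle_action_mem:
  "x \<in> cycle_points A \<Longrightarrow> cycle_action A g x \<in> cycle_points A"
  by (auto simp: cycle_action_def elim!: cycle_pointsE)

lemma cycle_action_inverse:
  "x \<in> cycle_points A \<Longrightarrow>
    cycle_action A (int_encode z) (cycle_action A (int_encode (- z)) x) = x"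
  using cycle_action_mem by (auto simp: cycle_action_def elim!: cycle_pointsE)

lemma group_action_cycle: "group_action int_group (cycle_points A) (cycle_action A)"
  unfolding group_action_def group_hom_def group_hom_axioms_def
proof (intro conjI homI)
  have bij: "cycle_action A g \<in> Bij (cycle_points A)" for g
  proof -
    have "cycle_action A g (cycle_action A (int_encode (- int_decode g)) x) = x"
      "cycle_action A (int_encode (- int_decode g)) (cycle_action A g x) = x"
      if "x \<in> cycle_points A" for x
      using cycle_action_inverse[OF that, of "int_decode g"]
        cycle_action_inverse[OF that, of "- int_decode g"] by simp_all
    then have "bij_betw (cycle_action A g) (cycle_points A) (cycle_points A)"
      using cycle_action_mem
      by (intro bij_betw_byWitness[where f' = "cycle_action A (int_encode (- int_decode g))"]) auto
    then show ?thesis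
      by (simp add: Bij_def cycle_action_def)
  qed
  show "cycle_action A g \<in> carrier (BijGroup (cycle_points A))" for g
    using bij by (simp add: BijGroup_def)
  show "cycle_action A (a \<otimes>\<^bsub>int_group\<^esub> b) =
      cycle_action A a \<otimes>\<^bsub>BijGroup (cycle_points A)\<^esub> cycle_action A b" for a b
  proof
    show "cycle_action A (a \<otimes>\<^bsub>int_group\<^esub> b) x =
        (cycle_action A a \<otimes>\<^bsub>BijGroup (cycle_points A)\<^esub> cycle_action A b) x" for x
      using bij by (cases "x \<in> cycle_points A")
        (auto simp: BijGroup_def compose_def cycle_action_def rot_rot elim!: cycle_pointsE)
  qed
qed (simp_all add: group_int_group group_BijGroup)

lemma homeomorphism_action_cycle:
  "homeomorphism_action int_group (cycle_topology A) (cycle_action A)"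
  unfolding homeomorphism_action_def
proof (intro conjI ballI)
  have cont: "continuous_map (cycle_topology A) (cycle_topology A) (cycle_action A g)" for g
  proof (rule Lipschitz_continuous_imp_continuous_map)
    show "Lipschitz_continuous_map (cycle_metric A) (cycle_metric A) (cycle_action A g)"
      unfolding Lipschitz_continuous_map_def
      using cycle_action_mem by (intro conjI exI[of _ 1]) (auto simp: cycle_action_def cycle_dist_rot)
  qed
  show "homeomorphic_map (cycle_topology A) (cycle_topology A) (cycle_action A g)" for g
  proof (rule homeomorphic_maps_imp_map)
    show "homeomorphic_maps (cycle_topology A) (cycle_topology A) (cycle_action A g)
        (cycle_action A (int_encode (- int_decode g)))"
      unfolding homeomorphic_maps_def
      using cont cycle_action_inverse[of _ A "int_decode g"]
        cycle_action_inverse[of _ A "- int_decode g"] by auto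
  qed
qed (simp add: group_action_cycle)

lemma orbit_sizes_cycle:
  "orbit_sizes int_group (cycle_points A) (cycle_action A) = Suc ` insert 0 (Suc ` A)"
proof -
  have card: "card (orbit int_group (cycle_action A) (\<lambda>_. n)) = Suc (cyc n)"
    if n: "cyc n \<in> insert 0 (Suc ` A)" for n
  proof -
    have "orbit int_group (cycle_action A) (\<lambda>_. n) = range (\<lambda>g _. rot (int_decode g) n)"
      using n by (auto simp: orbit_def cycle_action_def)
    also have "\<dots> = (\<lambda>m _. m) ` range (\<lambda>z. rot z n)"
      by (auto simp: image_image) (metis int_encode_inverse rangeI)
    also have "\<dots> = (\<lambda>p _. triangle (cyc n) + p) ` {..cyc n}"
      unfolding range_rot by (simp add: image_image)
    also have "card \<dots> = card {..cyc n}"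
      by (rule card_image) (auto simp: inj_on_def dest: fun_cong)
    finally show ?thesis
      by simp
  qed
  have points: "cycle_points A = (\<lambda>n _. n) ` {n. cyc n \<in> insert 0 (Suc ` A)}"
    unfolding cycle_points_def by blast
  have "orbit_sizes int_group (cycle_points A) (cycle_action A) =
      (\<lambda>n. Suc (cyc n)) ` {n. cyc n \<in> insert 0 (Suc ` A)}"
    unfolding orbit_sizes_def points image_image
    by (rule image_cong[OF refl]) (use card in \<open>simp only: mem_Collect_eq\<close>)
  also have "\<dots> = Suc ` insert 0 (Suc ` A)"
  proof -
    \<comment> \<open>Every index \<open>c\<close> is attained, at position 0 of its cycle, that is
      at \<open>triangle c\<close>.\<close>
    have "cyc ` {n. cyc n \<in> B} = B" for B
      using cyc_triangle[of 0] by (auto simp: image_iff) (metis add.right_neutral le0)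
    then show ?thesis
      by (metis image_image)
  qed
  finally show ?thesis .
qed

lemma cycle_factor_map:
  "topological_factor_map int_group (cycle_topology UNIV) (cycle_action UNIV)
     (cycle_topology A) (cycle_action A) (\<lambda>x. if x \<in> cycle_points A then x else (\<lambda>_. 0))"
    (is "topological_factor_map _ _ _ _ _ ?f")
  unfolding topological_factor_map_def
proof (intro conjI ballI)
  \<comment> \<open>Collapsing a point replaces its reciprocal index by 0, so no distance
    grows.\<close>
  have "mdist (cycle_metric A) (?f x) (?f y) \<le> mdist (cycle_metric UNIV) x y"
    if "x \<in> cycle_points UNIV" "y \<in> cycle_points UNIV" for x y
    using that by (elim cycle_pointsE) (auto simp: cycle_dist_def le_max_iff_disj)
  then have "Lipschitz_continuous_map (cycle_metric UNIV) (cycle_metric A) ?f"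
    unfolding Lipschitz_continuous_map_def by (intro conjI exI[of _ 1]) auto
  then show "continuous_map (cycle_topology UNIV) (cycle_topology A) ?f"
    by (rule Lipschitz_continuous_imp_continuous_map)
  have sub: "cycle_points A \<subseteq> cycle_points UNIV"
    unfolding cycle_points_def by auto
  then have "x \<in> ?f ` cycle_points UNIV" if "x \<in> cycle_points A" for x
    using that by (intro image_eqI[of _ _ x]) auto
  then show "?f ` topspace (cycle_topology UNIV) = topspace (cycle_topology A)"
    by auto
  show "?f (cycle_action UNIV g x) = cycle_action A g (?f x)"
    if "x \<in> topspace (cycle_topology UNIV)" for g x
  proof -
    have "x \<in> cycle_points UNIV"
      using that by simp
    then obtain n where n: "x = (\<lambda>_. n)"
      by (rule cycle_pointsE)
    \<comment> \<open>Whether a point is collapsed depends on its cycle alone, and the target of the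
      collapse is fixed by all rotations.\<close>
    have "(\<lambda>_. n) \<in> cycle_points A \<longleftrightarrow> (\<lambda>_. rot (int_decode g) n) \<in> cycle_points A"
      by simp
    then show ?thesis
      using that unfolding n by (auto simp: cycle_action_def simp del: const_mem_cycle_points)
        (simp_all add: rot_def)
  qed
qed

section \<open>Effectivity of the cycle action\<close>

lemma computable_cyc: "computable k f \<Longrightarrow> computable k (\<lambda>xs. cyc (f xs))"
  unfolding cyc_def by (intro computability_intros)

lemma computable_rot_one: "computable k f \<Longrightarrow> computable k (\<lambda>xs. rot 1 (f xs))"
  unfolding rot_one cyc_def pos_def by (intro computability_intros)

abbreviation const_point :: "nat \<Rightarrow> nat \<Rightarrow> nat" where
  "const_point n \<equiv> \<lambda>_. n"

lemma cycle_points_UNIV: "cycle_points UNIV = range const_point"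
  using const_mem_cycle_points_UNIV by (auto elim: cycle_pointsE)

text \<open>The larger reciprocal belongs to the smaller nonzero index, and denominator 0 encodes
  distance 0. Distances are thus rationals that can be output exactly.\<close>

definition cycle_dist_denominator :: "nat \<Rightarrow> nat \<Rightarrow> nat" where
  "cycle_dist_denominator m n =
     (if m = n then 0 else if cyc m = 0 then cyc n else if cyc n = 0 then cyc m
      else if cyc m \<le> cyc n then cyc m else cyc n)"

lemma cycle_dist_eq: "cycle_dist m n = 1 / real (cycle_dist_denominator m n)"
proof -
  have "max (1 / real a) (1 / real b) = 1 / real (if a \<le> b then a else b)" if "a \<noteq> 0" "b \<noteq> 0" for a b
    using that by (auto simp: max_def field_simps)
  then show ?thesis
    by (simp add: cycle_dist_def cycle_dist_denominator_def)
qed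

text \<open>A nonnegative integer \<open>k\<close> has code \<open>2 * k\<close>, so the pair
  encodes numerator 1 and denominator \<open>n\<close>; for \<open>n = 0\<close> both sides are
  0.\<close>

lemma nat_to_rat_surj_one_over_nat:
  "real_of_rat (nat_to_rat_surj (prod_encode (2, 2 * n))) = 1 / real n"
proof -
  have "int_decode 2 = 1" "int_decode (2 * n) = int n"
    by (simp_all add: int_decode_def sum_decode_def)
  then have "nat_to_rat_surj (prod_encode (2, 2 * n)) = 1 / of_nat n"
    by (simp add: nat_to_rat_surj_def Fract_of_int_quotient)
  then show ?thesis
    by (simp add: of_rat_divide)
qed

lemma computable_metric_space_cycle:
  "computable_metric_space (cycle_metric UNIV) const_point"
  unfolding computable_metric_space_def
proof (intro conjI)
  have range: "range const_point = mspace (cycle_metric UNIV)"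
    by (simp add: cycle_points_UNIV)
  then show "range const_point \<subseteq> mspace (cycle_metric UNIV)"
    by simp
  show "Abstract_Topology.closure_of (cycle_topology UNIV) (range const_point) = mspace (cycle_metric UNIV)"
    unfolding range by (metis closure_of_topspace topspace_mtopology_of)
  have "computable 3 (\<lambda>xs. prod_encode (2, 2 * cycle_dist_denominator (xs ! 0) (xs ! 1)))"
    unfolding cycle_dist_denominator_def by (intro computability_intros computable_cyc) simp_all
  then obtain p where p: "\<And>xs. length xs = 3 \<Longrightarrow>
      run p xs = Some (prod_encode (2, 2 * cycle_dist_denominator (xs ! 0) (xs ! 1)))"
    unfolding computable_def by blast
  show "\<exists>p. \<forall>i j n. \<exists>r. run p [i, j, n] = Some r \<and>
      \<bar>mdist (cycle_metric UNIV) (const_point i) (const_point j) - real_of_rat (nat_to_rat_surj r)\<bar>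
        \<le> (1/2) ^ n"
    by (rule exI[of _ p]) (simp add: p nat_to_rat_surj_one_over_nat cycle_dist_eq)
qed

text \<open>Clearing denominators leaves a decidable inequality of naturals; \<open>c = 0\<close> is
  separate because \<open>1 / 0 = 0\<close> lies below every radius.\<close>

lemma one_over_less_fraction_iff:
  "1 / real c < real (Suc a) / real (Suc b) \<longleftrightarrow> c = 0 \<or> Suc b < Suc a * c"
proof (cases "c = 0")
  case False
  then have "1 / real c < real (Suc a) / real (Suc b) \<longleftrightarrow> real (Suc b) < real (Suc a) * real c"
    by (simp add: field_simps)
  also have "\<dots> \<longleftrightarrow> Suc b < Suc a * c"
    by (metis of_nat_less_iff of_nat_mult)
  finally show ?thesis
    using False by simp
qed simp

definition reciprocal_less :: "nat \<Rightarrow> nat \<Rightarrow> bool" where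
  "reciprocal_less c k \<longleftrightarrow> c = 0 \<or> Suc (snd (prod_decode k)) < Suc (fst (prod_decode k)) * c"

text \<open>Membership in a basic ball with the reals eliminated: a maximum is below the radius iff
  both of its terms are.\<close>

definition in_ball :: "nat \<Rightarrow> nat \<Rightarrow> bool" where
  "in_ball x n \<longleftrightarrow> x = fst (prod_decode n) \<or>
     reciprocal_less (cyc x) (snd (prod_decode n)) \<and>
     reciprocal_less (cyc (fst (prod_decode n))) (snd (prod_decode n))"

lemma decidable_in_ball:
  "computable k f \<Longrightarrow> computable k g \<Longrightarrow> decidable k (\<lambda>xs. in_ball (f xs) (g xs))"
  unfolding in_ball_def reciprocal_less_def by (intro computability_intros computable_cyc)

lemma const_point_mem_basic_ball:
  "const_point x \<in> basic_ball (cycle_metric UNIV) const_point n \<longleftrightarrow> in_ball x n"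
proof -
  obtain i k where n: "prod_decode n = (i, k)"
    by (cases "prod_decode n")
  obtain a b where k: "prod_decode k = (a, b)"
    by (cases "prod_decode k")
  have "const_point x \<in> basic_ball (cycle_metric UNIV) const_point n \<longleftrightarrow>
      cycle_dist i x < real (Suc a) / real (Suc b)"
    unfolding basic_ball_def n by (simp add: k del: const_mem_cycle_points)
  also have "\<dots> \<longleftrightarrow> i = x \<or> 1 / real (cyc i) < real (Suc a) / real (Suc b) \<and>
      1 / real (cyc x) < real (Suc a) / real (Suc b)"
    by (simp add: cycle_dist_def)
  also have "\<dots> \<longleftrightarrow> in_ball x n"
    unfolding one_over_less_fraction_iff in_ball_def reciprocal_less_def n fst_conv snd_conv k by auto
  finally show ?thesis .
qed

lemma less_if_mem_set_decode:
  assumes "n \<in> set_decode e"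
  shows "n < e"
proof -
  have "e div 2 ^ n \<noteq> 0"
    using assms by (auto simp: set_decode_def intro: ccontr)
  then have "2 ^ n \<le> e"
    by (simp add: div_eq_0_iff)
  then show ?thesis
    using less_exp[of n] by linarith
qed

text \<open>A ball containing the limit point \<open>0\<close> contains every cycle whose index exceeds the
  denominator of its radius, and that denominator is at most \<open>e\<close>; so only finitely many points need checking.\<close>

lemma cover_iff_bounded:
  "(\<forall>x. \<exists>n\<in>set_decode e. in_ball x n) \<longleftrightarrow>
   (\<forall>x<triangle (Suc e). \<exists>n<e. n \<in> set_decode e \<and> in_ball x n)"
proof
  assume "\<forall>x. \<exists>n\<in>set_decode e. in_ball x n"
  then show "\<forall>x<triangle (Suc e). \<exists>n<e. n \<in> set_decode e \<and> in_ball x n"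
    using less_if_mem_set_decode by blast
next
  assume *: "\<forall>x<triangle (Suc e). \<exists>n<e. n \<in> set_decode e \<and> in_ball x n"
  have "0 < triangle (Suc e)"
    by simp
  then obtain n where n: "n < e" "n \<in> set_decode e" "in_ball 0 n"
    using * by blast
  define k where "k = snd (prod_decode n)"
  have "snd (prod_decode k) \<le> k"
    using le_prod_encode_2[of "snd (prod_decode k)" "fst (prod_decode k)"] by simp
  also have "\<dots> \<le> n"
    using le_prod_encode_2[of "snd (prod_decode n)" "fst (prod_decode n)"] by (simp add: k_def)
  finally have b: "Suc (snd (prod_decode k)) \<le> e"
    using n(1) by linarith
  \<comment> \<open>If the ball is centred at 0 this holds since \<open>cyc 0 = 0\<close>; otherwise
    it is part of \<open>in_ball 0 n\<close>.\<close>
  have centre: "reciprocal_less (cyc (fst (prod_decode n))) k"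
    using n(3) unfolding in_ball_def k_def[symmetric] by (auto simp: reciprocal_less_def)
  show "\<forall>x. \<exists>n\<in>set_decode e. in_ball x n"
  proof
    fix x
    show "\<exists>n\<in>set_decode e. in_ball x n"
    proof (cases "x < triangle (Suc e)")
      case False
      then have "e < cyc x"
        using less_triangle_if_cyc_le[of x e] by force
      then have "Suc (snd (prod_decode k)) < Suc (fst (prod_decode k)) * cyc x"
        using b by simp
      then have "in_ball x n"
        using centre by (simp add: in_ball_def reciprocal_less_def k_def)
      then show ?thesis
        using n(2) by blast
    qed (use * in blast)
  qed
qed

lemma recursively_compact_cycle:
  "recursively_compact (cycle_metric UNIV) const_point (cycle_points UNIV)"
  unfolding recursively_compact_def
proof (intro conjI)
  show "compactin (cycle_topology UNIV) (cycle_points UNIV)"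
    using compact_space_cycle[of UNIV] by (simp add: compact_space_def)
  have "decidable 1 (\<lambda>xs. \<forall>x<triangle (Suc (xs ! 0)). \<exists>n<xs ! 0.
      n \<in> set_decode (xs ! 0) \<and> in_ball x n)"
    by (intro computability_intros decidable_in_ball) simp_all
  \<comment> \<open>A dummy search variable turns the decision into a program that halts at once
    when the family covers and never halts otherwise.\<close>
  then have "decidable (Suc 1) (\<lambda>ys. \<forall>x<triangle (Suc (tl ys ! 0)). \<exists>n<tl ys ! 0.
      n \<in> set_decode (tl ys ! 0) \<and> in_ball x n)"
    unfolding decidable_def by (rule computable_weaken)
  from unbounded_search[where k = 1 and P = "\<lambda>m xs. \<forall>x<triangle (Suc (xs ! 0)). \<exists>n<xs ! 0.
      n \<in> set_decode (xs ! 0) \<and> in_ball x n", OF this]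
  obtain p where p: "\<And>xs. length xs = 1 \<Longrightarrow> run p xs \<noteq> None \<longleftrightarrow>
      (\<forall>x<triangle (Suc (xs ! 0)). \<exists>n<xs ! 0. n \<in> set_decode (xs ! 0) \<and> in_ball x n)"
    by (metis (no_types, lifting) option.distinct(1))
  have "run p [set_encode I] \<noteq> None \<longleftrightarrow>
      cycle_points UNIV \<subseteq> (\<Union>n\<in>I. basic_ball (cycle_metric UNIV) const_point n)"
    if I: "finite I" for I
  proof -
    have "run p [set_encode I] \<noteq> None \<longleftrightarrow> (\<forall>x. \<exists>n\<in>I. in_ball x n)"
      using p[of "[set_encode I]"] cover_iff_bounded[of "set_encode I"] I by simp
    also have "\<dots> \<longleftrightarrow> (\<forall>x. const_point x \<in> (\<Union>n\<in>I. basic_ball (cycle_metric UNIV) const_point n))"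
      by (simp add: const_point_mem_basic_ball)
    also have "\<dots> \<longleftrightarrow> cycle_points UNIV \<subseteq> (\<Union>n\<in>I. basic_ball (cycle_metric UNIV) const_point n)"
      by (simp add: cycle_points_UNIV image_subset_iff)
    finally show ?thesis .
  qed
  then show "\<exists>p. \<forall>I. finite I \<longrightarrow> (run p [set_encode I] \<noteq> None \<longleftrightarrow>
      cycle_points UNIV \<subseteq> (\<Union>n\<in>I. basic_ball (cycle_metric UNIV) const_point n))"
    by blast
qed

lemma in_ball_iff_cycle_dist:
  "in_ball x n \<longleftrightarrow> cycle_dist (fst (prod_decode n)) x <
     real (Suc (fst (prod_decode (snd (prod_decode n))))) /
     real (Suc (snd (prod_decode (snd (prod_decode n)))))"
  unfolding const_point_mem_basic_ball[symmetric] basic_ball_def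
  by (simp add: case_prod_unfold Let_def del: const_mem_cycle_points)

text \<open>Since \<open>rot 1\<close> is an isometry, the preimage of a basic ball is a basic ball of the same
  radius.\<close>

lemma in_ball_rot_one:
  assumes "rot 1 (fst (prod_decode k)) = fst (prod_decode j)" "snd (prod_decode k) = snd (prod_decode j)"
  shows "in_ball (rot 1 x) j \<longleftrightarrow> in_ball x k"
  unfolding in_ball_iff_cycle_dist assms(1)[symmetric] cycle_dist_rot assms(2) ..

lemma computable_map_on_cycle:
  "computable_map_on (cycle_metric UNIV) const_point (cycle_points UNIV)
     (cycle_metric UNIV) const_point (cycle_action UNIV (int_encode 1))"
  unfolding computable_map_on_def
proof (intro conjI)
  show "cycle_action UNIV (int_encode 1) ` cycle_points UNIV \<subseteq> mspace (cycle_metric UNIV)"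
    using cycle_action_mem by auto
  \<comment> \<open>Ball \<open>k\<close> is ball \<open>j\<close> rotated back. Stated as a
    relation checked forwards, it avoids computing the inverse rotation.\<close>
  define shift where "shift j k \<longleftrightarrow> rot 1 (fst (prod_decode k)) = fst (prod_decode j) \<and>
    snd (prod_decode k) = snd (prod_decode j)" for j k
  \<comment> \<open>Pinning the search variable to \<open>k\<close> makes the program output
    \<open>k\<close> if \<open>shift j k\<close> holds and diverge otherwise, so that its outputs
    are exactly the wanted indices.\<close>
  have "decidable (Suc 2) (\<lambda>ys. ys ! 0 = tl ys ! 1 \<and> shift (tl ys ! 0) (tl ys ! 1))"
    unfolding shift_def by (intro computability_intros computable_rot_one) simp_all
  from unbounded_search[where k = 2 and P = "\<lambda>m xs. m = xs ! 1 \<and> shift (xs ! 0) (xs ! 1)", OF this]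
  obtain p where p: "\<And>xs. length xs = 2 \<Longrightarrow> run p xs =
      (if \<exists>m. m = xs ! 1 \<and> shift (xs ! 0) (xs ! 1)
       then Some (LEAST m. m = xs ! 1 \<and> shift (xs ! 0) (xs ! 1)) else None)"
    by blast
  have "(LEAST m. m = k \<and> Q) = k" if Q for k :: nat and Q
    using that by (intro Least_equality) auto
  then have run: "run p [j, k] = (if shift j k then Some k else None)" for j k
    using p[of "[j, k]"] by simp
  have enum: "(\<exists>k. run p [j, k] = Some n) \<longleftrightarrow> shift j n" for j n
    by (auto simp: run split: if_splits)
  have ex: "\<exists>k. shift j k" for j
    unfolding shift_def
    by (rule exI[of _ "prod_encode (rot (- 1) (fst (prod_decode j)), snd (prod_decode j))"]) simp
  have pre: "in_ball (rot 1 x) j \<longleftrightarrow> (\<exists>k. shift j k \<and> in_ball x k)" for x j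
    using ex[of j] in_ball_rot_one unfolding shift_def by metis
  have "{y \<in> cycle_points UNIV.
        cycle_action UNIV (int_encode 1) y \<in> basic_ball (cycle_metric UNIV) const_point j} =
      (\<Union>n\<in>{n. \<exists>k. run p [j, k] = Some n}. basic_ball (cycle_metric UNIV) const_point n) \<inter>
      cycle_points UNIV" for j
  proof -
    have "cycle_action UNIV (int_encode 1) y \<in> basic_ball (cycle_metric UNIV) const_point j \<longleftrightarrow>
        (\<exists>n. (\<exists>k. run p [j, k] = Some n) \<and> y \<in> basic_ball (cycle_metric UNIV) const_point n)"
      if y: "y \<in> cycle_points UNIV" for y
    proof -
      obtain x where x: "y = const_point x"
        using y by (rule cycle_pointsE)
      have "cycle_action UNIV (int_encode 1) y = const_point (rot 1 x)"
        using y by (simp add: cycle_action_def x)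
      then show ?thesis
        by (simp add: x enum const_point_mem_basic_ball pre)
    qed
    then show ?thesis
      by blast
  qed
  then show "\<exists>p. \<forall>j. {y \<in> cycle_points UNIV.
        cycle_action UNIV (int_encode 1) y \<in> basic_ball (cycle_metric UNIV) const_point j} =
      (\<Union>n\<in>{n. \<exists>k. run p [j, k] = Some n}. basic_ball (cycle_metric UNIV) const_point n) \<inter>
      cycle_points UNIV"
    by blast
qed

lemma effective_cycle_action:
  "effective_dynamical_system int_group (cycle_topology UNIV) (cycle_action UNIV)"
proof (rule effective_dynamical_systemI[OF computable_metric_space_cycle recursively_compact_cycle])
  have top: "subtopology (cycle_topology UNIV) (cycle_points UNIV) = cycle_topology UNIV"
    by (metis mspace_cycle_metric subtopology_topspace topspace_mtopology_of)
  show "computable_action int_group (cycle_metric UNIV) const_point (cycle_points UNIV) (cycle_action UNIV)"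
    unfolding computable_action_def top
  proof (intro conjI exI)
    show "homeomorphism_action int_group (cycle_topology UNIV) (cycle_action UNIV)"
      by (rule homeomorphism_action_cycle)
    show "generate int_group {int_encode 1} = carrier int_group"
      by (rule generate_int_group)
  qed (use computable_map_on_cycle in simp_all)
  show "topologically_conjugate int_group (cycle_topology UNIV) (cycle_action UNIV)
      (subtopology (cycle_topology UNIV) (cycle_points UNIV)) (cycle_action UNIV)"
    unfolding top topologically_conjugate_def
    by (rule exI[of _ "\<lambda>x. x"]) (simp add: topological_factor_map_def homeomorphic_map_id[unfolded id_def])
qed

section \<open>The counting argument\<close>

lemma cycle_action_not_eds:
  "\<exists>A. \<not> effective_dynamical_system int_group (cycle_topology A) (cycle_action A)"
proof (rule ccontr)
  assume "\<not> ?thesis"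
  then have "\<exists>c (m :: (nat \<Rightarrow> nat) metric) s K \<alpha>. presents c int_group m s K \<alpha> \<and>
      orbit_sizes int_group K \<alpha> = Suc ` insert 0 (Suc ` A)" for A
    using effective_dynamical_system_presents[OF homeomorphism_action_cycle[of A]]
    by (simp add: orbit_sizes_cycle)
  then obtain c where c: "\<And>A. \<exists>(m :: (nat \<Rightarrow> nat) metric) s K \<alpha>.
      presents (c A) int_group m s K \<alpha> \<and>
      orbit_sizes int_group K \<alpha> = Suc ` insert 0 (Suc ` A)"
    by metis
  have "A = B" if "c A = c B" for A B
  proof -
    \<comment> \<open>Size 1 always occurs, and size \<open>a + 2\<close> occurs exactly for
      \<open>a\<close> in the family, so the sizes recover it.\<close>
    have "Suc ` insert 0 (Suc ` A) = Suc ` insert 0 (Suc ` B)"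
      using c[of A] c[of B] presents_orbit_sizes_eq that by metis
    then show ?thesis
      by (auto simp: set_eq_iff image_iff)
  qed
  \<comment> \<open>Codes over \<open>nat\<close> and \<open>recf\<close> are countable, so they
    would inject \<open>nat set\<close> into \<open>nat\<close>, against Cantor.\<close>
  then have "inj (\<lambda>A. to_nat (c A))"
    by (auto simp: inj_def)
  then have "surj (inv_into UNIV (\<lambda>A. to_nat (c A)))"
    by (rule inj_imp_surj_inv)
  then show False
    using Cantors_theorem[of UNIV] by auto
qed

theorem proposition8p3:
  shows "\<exists>(\<Gamma> :: nat monoid) (X :: (nat \<Rightarrow> nat) topology) \<phi> (Y :: (nat \<Rightarrow> nat) topology) \<psi>.
    finitely_generated_group \<Gamma> \<and>
    zero_dimensional X \<and> homeomorphism_action \<Gamma> X \<phi> \<and>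
    effective_dynamical_system \<Gamma> X \<phi> \<and>
    zero_dimensional Y \<and> homeomorphism_action \<Gamma> Y \<psi> \<and>
    (\<exists>f. topological_factor_map \<Gamma> X \<phi> Y \<psi> f) \<and>
    \<not> effective_dynamical_system \<Gamma> Y \<psi>"
proof -
  obtain A where "\<not> effective_dynamical_system int_group (cycle_topology A) (cycle_action A)"
    using cycle_action_not_eds by blast
  then show ?thesis
    using finitely_generated_int_group zero_dimensional_cycle homeomorphism_action_cycle
      effective_cycle_action cycle_factor_map by blast
qed

end
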